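(* There exist constants $c$ and $c'$ such that, if $H \in \mathcal{G}(t, \rho)$ is a random graph with $\rho \geq c' \frac{\log^{3/2} t}{\sqrt{t}}$, then $H$ almost surely satisfies \[r(H) \leq 2^{c \rho \log(2/\rho)\, t}.\]
   Context: The Ramsey number $r(H)$ of a graph $H$ is the smallest natural number $n$ such that in any two-colouring of the edges of the complete graph $K_n$ there is a monochromatic copy of $H$ (as a not necessarily induced subgraph). The binomial random graph $\mathcal{G}(t,\rho)$ is the probability space of all labelled graphs on $t$ vertices where each edge is chosen independently with probability $\rho$; here $\rho=\rho(t)$ may depend on $t$. The random graph $\mathcal{G}(t,\rho)$ has a property almost surely if the probability that it has the property tends to $1$ as $t \to \infty$. All logarithms are to base 2, and $\log^{3/2} x$ means $(\log x)^{3/2}$. *)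

theory Defs
  imports "HOL-Probability.Probability" "HOL-Library.Ramsey"
begin

text \<open>A graph is a pair of a vertex set and an edge set; the finite simple graphs are those with
  a finite vertex set \<open>V\<close> whose edge set is contained in \<^term>\<open>nsets V 2\<close>.\<close>

type_synonym 'a sgraph = "'a set \<times> 'a set set"

abbreviation verts :: "'a sgraph \<Rightarrow> 'a set" where "verts \<equiv> fst"

abbreviation edges :: "'a sgraph \<Rightarrow> 'a set set" where "edges \<equiv> snd"

definition finite_simple_graph :: "'a sgraph \<Rightarrow> bool" where
  "finite_simple_graph H \<longleftrightarrow> finite (verts H) \<and> edges H \<subseteq> nsets (verts H) 2"

text \<open>Copies are not required to be induced.\<close>

definition contains_copy :: "'b sgraph \<Rightarrow> 'a sgraph \<Rightarrow> bool" where
  "contains_copy G H \<longleftrightarrow>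
     (\<exists>f. inj_on f (verts H) \<and> f ` verts H \<subseteq> verts G \<and> (\<forall>e\<in>edges H. f ` e \<in> edges G))"

definition colour_class :: "nat \<Rightarrow> (nat set \<Rightarrow> bool) \<Rightarrow> bool \<Rightarrow> nat sgraph" where
  "colour_class n k i = ({..<n}, {e \<in> nsets {..<n} 2. k e = i})"

text \<open>The colouring \<open>k\<close> is a total function, but only its values on the edges of the complete
  graph on \<open>{..<n}\<close> matter.\<close>

definition ramsey_arrows :: "nat \<Rightarrow> 'a sgraph \<Rightarrow> bool" where
  "ramsey_arrows n H \<longleftrightarrow> (\<forall>k. \<exists>i. contains_copy (colour_class n k i) H)"

definition ramsey_number :: "'a sgraph \<Rightarrow> nat" where
  "ramsey_number H = (LEAST n. ramsey_arrows n H)"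

text \<open>By Ramsey's theorem the minimum above is attained for every finite simple graph.\<close>

lemma ramsey_arrows_ramsey_number:
  assumes "finite_simple_graph H"
  shows "ramsey_arrows (ramsey_number H) H"
proof -
  define V where "V = verts H"
  have V: "finite V" and E: "edges H \<subseteq> nsets V 2"
    using assms by (auto simp: finite_simple_graph_def V_def)
  obtain r where r: "\<And>(W::nat set) F. finite W \<Longrightarrow> card W \<ge> r \<Longrightarrow>
      \<exists>R\<subseteq>W. card R = card V \<and> clique R F \<or> card R = card V \<and> indep R F"
    using ramsey2[of "card V" "card V"] by blast
  have "ramsey_arrows r H"
    unfolding ramsey_arrows_def
  proof
    fix k :: "nat set \<Rightarrow> bool"
    obtain R where R: "R \<subseteq> {..<r}" "card R = card V"
      and mono: "clique R {e. k e} \<or> indep R {e. k e}"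
      using r[of "{..<r}" "{e. k e}"] by auto
    have "finite R" using R(1) finite_subset by blast
    then obtain f where f: "bij_betw f V R"
      using V R(2) finite_same_card_bij by metis
    from mono obtain i where i: "\<And>x y. x \<in> R \<Longrightarrow> y \<in> R \<Longrightarrow> x \<noteq> y \<Longrightarrow> k {x, y} = i"
      by (auto simp: clique_def indep_def)
    have "f ` e \<in> edges (colour_class r k i)" if "e \<in> edges H" for e
    proof -
      from that E obtain x y where e: "e = {x, y}" "x \<in> V" "y \<in> V" "x \<noteq> y"
        by (meson nsets2_E subsetD)
      then have "f x \<in> R" "f y \<in> R" "f x \<noteq> f y"
        using f by (auto simp: bij_betw_def inj_on_def)
      then show ?thesis
        using i R(1) by (auto simp: colour_class_def e)
    qed
    then have "contains_copy (colour_class r k i) H"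
      using f R(1) unfolding contains_copy_def V_def
      by (intro exI[of _ f]) (auto simp: bij_betw_def colour_class_def)
    then show "\<exists>i. contains_copy (colour_class r k i) H" ..
  qed
  then show ?thesis
    unfolding ramsey_number_def by (rule LeastI)
qed

text \<open>The binomial random graph on the labelled vertex set \<open>{..<t}\<close>. Points outside the index set
  of the product get the default value \<^term>\<open>False\<close>, so only elements of \<^term>\<open>nsets {..<t} 2\<close>
  become edges. Meaningful for \<open>0 \<le> \<rho> \<le> 1\<close>.\<close>

definition binomial_random_graph :: "nat \<Rightarrow> real \<Rightarrow> nat sgraph pmf" where
  "binomial_random_graph t \<rho> =
     map_pmf (\<lambda>b. ({..<t}, {e. b e})) (Pi_pmf (nsets {..<t} 2) False (\<lambda>_. bernoulli_pmf \<rho>))"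

lemma finite_simple_graph_binomial_random_graph:
  assumes "H \<in> set_pmf (binomial_random_graph t \<rho>)"
  shows "finite_simple_graph H"
proof -
  have "finite (nsets {..<t} 2)" by (simp add: finite_imp_finite_nsets)
  with assms show ?thesis
    by (auto simp: binomial_random_graph_def finite_simple_graph_def set_Pi_pmf PiE_dflt_def)
qed

end

theory Submission
  imports Defs
begin

text \<open>Write \<open>L = \<rho> * log 2 (2 / \<rho>)\<close>, and let the edges on a set of \<open>2 powr (c * L * t)\<close> points be
  coloured with two colours. The random graph \<open>H\<close> enters only
  through one property: almost surely every nonempty set of \<open>s\<close> vertices spans fewer than
  \<open>\<rho> * s\<^sup>2 + 2 * s * log 2 t\<close> edges (\<open>prob_dense_subset_le\<close>). So if
  \<open>\<rho>\<^sup>2 * t \<ge> log 2 t\<close>, all subgraphs of \<open>H\<close> on at most \<open>s\<close> vertices with \<open>s \<ge> \<rho> * t\<close> are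
  \<open>O(\<rho> * s)\<close>-degenerate: the bound on the degeneracy decreases in proportion to the size, whichever vertices are
  chosen.

  Three tools are used. First, if a subgraph on at most \<open>s \<ge> \<rho> * t\<close> vertices has no copy of colour \<open>i\<close> in a set \<open>B\<close>,
  then the greedy embedding gets stuck at large sets \<open>X\<close> and \<open>Y\<close> with colour density
  less than \<open>\<rho> / 4\<close> between them; by degeneracy they occupy a fraction \<open>2 powr (- O(L * s))\<close> of \<open>B\<close>
  (\<open>sparse_pair_if_no_copy\<close>). Second, if \<open>X\<close> contains a copy of some \<open>s\<close> vertices in the other
  colour, then half of this copy is joined in that colour to all of a subset of \<open>Y\<close>, again at a loss of
  \<open>2 powr O(L * s)\<close>, since almost all edges between the two have the right colour
  (\<open>complete_to_most_of_copy\<close>). Third, every set of size at least \<open>2 powr (4 * L * t)\<close>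
  contains either a monochromatic clique on \<open>t\<close> vertices or cliques on \<open>\<rho> * t\<close> vertices in both colours
  (\<open>erdos_szekeres_off_diagonal\<close>).

  The tools are combined by following a scale \<open>\<mu>\<close> such that some subgraph on at most \<open>\<mu>\<close> vertices is
  known to be missing in some colour. The first tool is applied at this scale. Either \<open>X\<close> already misses
  a subgraph of half the size, and the scale drops by a factor of 2; or \<open>X\<close> contains all
  subgraphs of half the size in both colours, and the second tool embeds a quarter of \<open>\<mu>\<close> new vertices for good,
  up to rounding. A missing subgraph stays missing in subsets, so the scale never
  increases. Hence the losses in the exponent are a geometric series for the scale and
  \<open>O(L)\<close> for every embedded vertex, \<open>O(L * t)\<close> in total; and the third tool ensures that the scale never falls
  below \<open>\<rho> * t\<close>. The process ends with a complete copy of \<open>H\<close> in one of the colours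
  (\<open>mono_copy_of_remainder\<close>).\<close>

section \<open>Monochromatic copies\<close>

definition monochromatic_on :: "('b set \<Rightarrow> bool) \<Rightarrow> bool \<Rightarrow> 'a set set \<Rightarrow> ('a \<Rightarrow> 'b) \<Rightarrow> 'a set \<Rightarrow> bool" where
  "monochromatic_on k i E f S \<longleftrightarrow>
     (\<forall>u\<in>S. \<forall>v\<in>S. u \<noteq> v \<longrightarrow> {u, v} \<in> E \<longrightarrow> k {f u, f v} = i)"

lemma monochromatic_onD:
  "monochromatic_on k i E f S \<Longrightarrow> u \<in> S \<Longrightarrow> v \<in> S \<Longrightarrow> u \<noteq> v \<Longrightarrow> {u, v} \<in> E \<Longrightarrow> k {f u, f v} = i"
  by (simp add: monochromatic_on_def)

lemma monochromatic_on_subset: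
  "monochromatic_on k i E f S \<Longrightarrow> S' \<subseteq> S \<Longrightarrow> monochromatic_on k i E f S'"
  by (simp add: monochromatic_on_def subset_iff)

definition mono_copy :: "('b set \<Rightarrow> bool) \<Rightarrow> bool \<Rightarrow> 'a set set \<Rightarrow> 'a set \<Rightarrow> 'b set \<Rightarrow> bool" where
  "mono_copy k i E S B \<longleftrightarrow> (\<exists>f. inj_on f S \<and> f ` S \<subseteq> B \<and> monochromatic_on k i E f S)"

lemma mono_copy_mono:
  assumes "mono_copy k i E S B" "S' \<subseteq> S" "B \<subseteq> B'"
  shows "mono_copy k i E S' B'"
proof -
  obtain f where "inj_on f S" "f ` S \<subseteq> B" "monochromatic_on k i E f S"
    using assms(1) unfolding mono_copy_def by blast
  with assms(2,3) show ?thesis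
    unfolding mono_copy_def
    by (intro exI[of _ f]) (auto intro: inj_on_subset monochromatic_on_subset)
qed

definition nbrs :: "('b set \<Rightarrow> bool) \<Rightarrow> bool \<Rightarrow> 'b \<Rightarrow> 'b set" where
  "nbrs k i x = {y. y \<noteq> x \<and> k {x, y} = i}"

definition sparse_pair :: "('b set \<Rightarrow> bool) \<Rightarrow> bool \<Rightarrow> real \<Rightarrow> 'b set \<Rightarrow> 'b set \<Rightarrow> bool" where
  "sparse_pair k i \<epsilon> X Y \<longleftrightarrow> (\<forall>x\<in>X. real (card (nbrs k i x \<inter> Y)) < \<epsilon> * real (card Y))"

text \<open>Vertex sets are embedded piecewise: a copy on one part of the vertices extends by a copy on the
  rest as soon as the latter lies in the common neighbourhood of the former.\<close>

lemma mono_copy_join: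
  assumes f: "inj_on f S" "f ` S \<subseteq> B" "monochromatic_on k i E f S"
    and C: "mono_copy k i E R C" "C \<subseteq> B - f ` S"
    and complete: "\<And>u y. u \<in> S \<Longrightarrow> y \<in> C \<Longrightarrow> k {f u, y} = i"
  shows "mono_copy k i E (S \<union> R) B"
proof -
  obtain g where g: "inj_on g R" "g ` R \<subseteq> C" "monochromatic_on k i E g R"
    using C(1) unfolding mono_copy_def by blast
  define h where "h x = (if x \<in> S then f x else g x)" for x
  have hS: "h x = f x" if "x \<in> S" for x using that by (simp add: h_def)
  have hR: "h x = g x" if "x \<in> R - S" for x using that by (simp add: h_def)
  have gR: "g x \<in> C" "g x \<in> B" "g x \<notin> f ` S" if "x \<in> R" for x
    using that g(2) C(2) by auto
  have "inj_on h (S \<union> R)"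
  proof (rule inj_onI)
    fix x y assume "x \<in> S \<union> R" "y \<in> S \<union> R" "h x = h y"
    then consider "x \<in> S" "y \<in> S" "f x = f y" | "x \<in> S" "y \<in> R" "f x = g y"
      | "y \<in> S" "x \<in> R" "g x = f y" | "x \<in> R" "y \<in> R" "g x = g y"
      by (auto simp: h_def split: if_splits)
    then show "x = y"
    proof cases
      case 1 then show ?thesis using f(1) by (simp add: inj_on_eq_iff)
    next
      case 2 then show ?thesis using gR(3)[of y] by (metis imageI)
    next
      case 3 then show ?thesis using gR(3)[of x] by (metis imageI)
    next
      case 4 then show ?thesis using g(1) by (simp add: inj_on_eq_iff)
    qed
  qed
  moreover have "h ` (S \<union> R) \<subseteq> B"
    using f(2) gR(2) by (auto simp: h_def)
  moreover have "k {h u, h v} = i"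
    if uv: "u \<in> S \<union> R" "v \<in> S \<union> R" "u \<noteq> v" "{u, v} \<in> E" for u v
  proof -
    consider "u \<in> S" "v \<in> S" | "u \<in> S" "v \<in> R - S" | "u \<in> R - S" "v \<in> S" | "u \<in> R - S" "v \<in> R - S"
      using uv by blast
    then show ?thesis
    proof cases
      case 1 then show ?thesis using monochromatic_onD[OF f(3)] uv hS by auto
    next
      case 2 then show ?thesis using complete gR(1) hS hR by auto
    next
      case 3
      then have "k {f v, g u} = i" using complete gR(1) by auto
      then show ?thesis using 3 hS hR by (simp add: insert_commute)
    next
      case 4 then show ?thesis using monochromatic_onD[OF g(3)] uv hR by auto
    qed
  qed
  ultimately show ?thesis
    unfolding mono_copy_def monochromatic_on_def by (intro exI[of _ h]) simp
qed

section \<open>A missing copy forces a sparse pair\<close>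

text \<open>A vertex of low degree goes last, and the remaining vertices are ordered recursively.\<close>

lemma degenerate_ordering:
  assumes "finite S"
    and "\<And>T. T \<subseteq> S \<Longrightarrow> T \<noteq> {} \<Longrightarrow> \<exists>v\<in>T. card {u\<in>T. {u, v} \<in> E} \<le> d"
  shows "\<exists>vs. distinct vs \<and> set vs = S \<and>
           (\<forall>xs w ys. vs = xs @ w # ys \<longrightarrow> card {u\<in>set xs. {u, w} \<in> E} \<le> d)"
  using assms
proof (induction "card S" arbitrary: S)
  case 0
  then show ?case by (intro exI[of _ "[]"]) auto
next
  case (Suc n)
  have "S \<noteq> {}" using Suc.hyps(2) by auto
  then obtain v where v: "v \<in> S" "card {u\<in>S. {u, v} \<in> E} \<le> d"
    using Suc.prems(2)[of S] by auto
  have "card (S - {v}) = n" using Suc.hyps(2) v(1) Suc.prems(1) by simp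
  then have "\<exists>vs. distinct vs \<and> set vs = S - {v} \<and>
      (\<forall>xs w ys. vs = xs @ w # ys \<longrightarrow> card {u\<in>set xs. {u, w} \<in> E} \<le> d)"
    using Suc.prems by (intro Suc.hyps(1)) auto
  then obtain vs where vs: "distinct vs" "set vs = S - {v}"
    "\<And>xs w ys. vs = xs @ w # ys \<Longrightarrow> card {u\<in>set xs. {u, w} \<in> E} \<le> d"
    by blast
  have "card {u\<in>set xs. {u, w} \<in> E} \<le> d" if eq: "vs @ [v] = xs @ w # ys" for xs w ys
  proof (cases ys rule: rev_cases)
    case Nil
    then have "xs = vs" "w = v" using eq by auto
    then have "{u\<in>set xs. {u, w} \<in> E} \<subseteq> {u\<in>S. {u, v} \<in> E}" using vs(2) by auto
    then have "card {u\<in>set xs. {u, w} \<in> E} \<le> card {u\<in>S. {u, v} \<in> E}"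
      using Suc.prems(1) by (intro card_mono) auto
    then show ?thesis using v(2) by linarith
  next
    case (snoc ys' z)
    then have "vs = xs @ w # ys'" using eq by auto
    then show ?thesis using vs(3) by blast
  qed
  then show ?case
    using vs v(1) by (intro exI[of _ "vs @ [v]"]) auto
qed

text \<open>Greedy embedding. Every vertex \<open>w\<close> not yet placed keeps a set \<open>U w\<close> of candidates, and placing
  one of its neighbours shrinks \<open>U w\<close> by a factor of at most \<open>1 / \<epsilon>\<close>; here \<open>b w\<close> bounds the number of
  neighbours of \<open>w\<close> still to be placed before \<open>w\<close>. A candidate for \<open>v\<close> is bad if it would shrink some
  \<open>U w\<close> too much. The candidates that are bad for a given \<open>w\<close> form a sparse pair with \<open>U w\<close>, so there
  are at most \<open>m\<close> of them because larger sparse pairs are excluded, and \<open>s\<close> such sets cannot exhaust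
  \<open>U v\<close>. The summand \<^term>\<open>length vs\<close> in the size condition pays for the points that are removed to keep the embedding injective.\<close>

lemma embed_ordered:
  fixes \<epsilon> m M :: real
  assumes "0 < \<epsilon>" "\<epsilon> \<le> 1"
    and no_sparse: "\<And>X Y. X \<subseteq> B \<Longrightarrow> Y \<subseteq> B \<Longrightarrow> m \<le> card X \<Longrightarrow> m \<le> card Y \<Longrightarrow> \<not> sparse_pair k i \<epsilon> X Y"
    and M: "real s * m \<le> M" "m \<le> M" "0 \<le> M"
    and "finite B"
    and "distinct vs" "length vs \<le> s"
    and "\<And>xs w ys. vs = xs @ w # ys \<Longrightarrow> card {u\<in>set xs. {u, w} \<in> E} \<le> b w"
    and "\<And>w. w \<in> set vs \<Longrightarrow> U w \<subseteq> B"
    and "\<And>w. w \<in> set vs \<Longrightarrow> M + real (length vs) \<le> \<epsilon> ^ b w * real (card (U w))"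
  shows "\<exists>f. inj_on f (set vs) \<and> (\<forall>v\<in>set vs. f v \<in> U v) \<and> monochromatic_on k i E f (set vs)"
  using assms(8-)
proof (induction vs arbitrary: b U)
  case Nil
  then show ?case by (simp add: monochromatic_on_def)
next
  case (Cons v vs)
  have Uge: "M + real (length (v # vs)) \<le> real (card (U w))" if "w \<in> set (v # vs)" for w
  proof -
    have "\<epsilon> ^ b w * real (card (U w)) \<le> 1 * real (card (U w))"
      using assms(1,2) by (intro mult_right_mono power_le_one) auto
    then show ?thesis using Cons.prems(5)[OF that] by linarith
  qed
  have finU: "finite (U w)" if "w \<in> set (v # vs)" for w
    using Cons.prems(4)[OF that] \<open>finite B\<close> finite_subset by blast
  define Bad where "Bad w = {x\<in>U v. real (card (nbrs k i x \<inter> U w)) < \<epsilon> * real (card (U w))}" for w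
  have Bad: "real (card (Bad w)) \<le> m" if w: "w \<in> set vs" for w
  proof (rule ccontr)
    assume "\<not> ?thesis"
    then have "m \<le> card (Bad w)" by simp
    moreover have "m \<le> card (U w)" using Uge[of w] w M(2) by auto
    moreover have "Bad w \<subseteq> B" using Cons.prems(4)[of v] by (auto simp: Bad_def)
    moreover have "U w \<subseteq> B" using Cons.prems(4) w by auto
    ultimately have "\<not> sparse_pair k i \<epsilon> (Bad w) (U w)" by (intro no_sparse)
    then show False unfolding sparse_pair_def Bad_def by auto
  qed
  have "\<exists>x\<in>U v. x \<notin> (\<Union>w\<in>set vs. Bad w)"
  proof (rule ccontr)
    assume "\<not> ?thesis"
    then have "U v \<subseteq> (\<Union>w\<in>set vs. Bad w)" by auto
    moreover have "finite (\<Union>w\<in>set vs. Bad w)" using finU by (auto simp: Bad_def)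
    ultimately have "real (card (U v)) \<le> real (card (\<Union>w\<in>set vs. Bad w))"
      by (simp add: card_mono)
    also have "\<dots> \<le> (\<Sum>w\<in>set vs. real (card (Bad w)))"
      by (metis card_UN_le finite_set of_nat_le_iff of_nat_sum)
    also have "\<dots> \<le> real (card (set vs)) * m"
      using Bad by (rule sum_bounded_above)
    also have "\<dots> \<le> M"
    proof (cases "m \<le> 0")
      case True
      then have "real (card (set vs)) * m \<le> 0" by (simp add: mult_nonneg_nonpos)
      then show ?thesis using M(3) by linarith
    next
      case False
      have "real (card (set vs)) \<le> real s" using Cons.prems(2) card_length[of vs] by auto
      then have "real (card (set vs)) * m \<le> real s * m" using False by (intro mult_right_mono) auto
      then show ?thesis using M(1) by linarith
    qed
    finally show False using Uge[of v] by auto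
  qed
  then obtain x where x: "x \<in> U v" "\<And>w. w \<in> set vs \<Longrightarrow> \<epsilon> * real (card (U w)) \<le> real (card (nbrs k i x \<inter> U w))"
    unfolding Bad_def by fastforce
  \<comment> \<open>Intersecting with \<^term>\<open>nbrs k i x\<close> removes \<open>x\<close> as well; a non-neighbour must drop it explicitly.\<close>
  define U' where "U' w = (if {v, w} \<in> E then nbrs k i x \<inter> U w else U w - {x})" for w
  define b' where "b' w = (if {v, w} \<in> E then b w - 1 else b w)" for w
  have v: "v \<notin> set vs" using Cons.prems(1) by auto
  have "\<exists>f. inj_on f (set vs) \<and> (\<forall>v\<in>set vs. f v \<in> U' v) \<and> monochromatic_on k i E f (set vs)"
  proof (rule Cons.IH[where b = b'])
    show "distinct vs" "length vs \<le> s" using Cons.prems by auto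
    show "card {u\<in>set xs. {u, w} \<in> E} \<le> b' w" if eq: "vs = xs @ w # ys" for xs w ys
    proof -
      have *: "card {u\<in>set (v # xs). {u, w} \<in> E} \<le> b w"
        using Cons.prems(3)[of "v # xs" w ys] eq by simp
      show ?thesis
      proof (cases "{v, w} \<in> E")
        case True
        then have "{u\<in>set (v # xs). {u, w} \<in> E} = insert v {u\<in>set xs. {u, w} \<in> E}" by auto
        moreover have "v \<notin> set xs" using v eq by auto
        ultimately have "card {u\<in>set (v # xs). {u, w} \<in> E} = Suc (card {u\<in>set xs. {u, w} \<in> E})" by simp
        then show ?thesis using * True by (simp add: b'_def)
      next
        case False
        then have "{u\<in>set (v # xs). {u, w} \<in> E} = {u\<in>set xs. {u, w} \<in> E}" by auto
        then show ?thesis using * False by (simp add: b'_def)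
      qed
    qed
    show "U' w \<subseteq> B" if "w \<in> set vs" for w
      using Cons.prems(4)[of w] that by (auto simp: U'_def)
    show "M + real (length vs) \<le> \<epsilon> ^ b' w * real (card (U' w))" if w: "w \<in> set vs" for w
    proof (cases "{v, w} \<in> E")
      case True
      obtain ys zs where split: "vs = ys @ w # zs" using w by (meson split_list)
      have "card {u\<in>set (v # ys). {u, w} \<in> E} \<le> b w"
        using Cons.prems(3)[of "v # ys" w zs] split by auto
      moreover have "card {v} \<le> card {u\<in>set (v # ys). {u, w} \<in> E}"
        using True by (intro card_mono) auto
      ultimately have "b w = Suc (b' w)" using True by (simp add: b'_def)
      then have "\<epsilon> ^ b w * real (card (U w)) = \<epsilon> ^ b' w * (\<epsilon> * real (card (U w)))" by simp
      also have "\<dots> \<le> \<epsilon> ^ b' w * real (card (U' w))"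
        using x(2)[OF w] True assms(1) by (intro mult_left_mono) (auto simp: U'_def)
      finally show ?thesis using Cons.prems(5)[of w] w by auto
    next
      case False
      have "real (card (U w)) - 1 \<le> real (card (U w - {x}))"
        using finU[of w] w by (auto simp: card_Diff_singleton_if)
      then have "\<epsilon> ^ b w * (real (card (U w)) - 1) \<le> \<epsilon> ^ b w * real (card (U w - {x}))"
        using assms(1) by (intro mult_left_mono) auto
      moreover have "\<epsilon> ^ b w \<le> 1" using assms(1,2) by (intro power_le_one) auto
      ultimately have "\<epsilon> ^ b w * real (card (U w)) - 1 \<le> \<epsilon> ^ b w * real (card (U w - {x}))"
        by (simp add: algebra_simps)
      then show ?thesis using Cons.prems(5)[of w] w False by (auto simp: U'_def b'_def)
    qed
  qed
  then obtain f where f: "inj_on f (set vs)" "\<And>v. v \<in> set vs \<Longrightarrow> f v \<in> U' v"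
    "monochromatic_on k i E f (set vs)" by blast
  define g where "g = f(v := x)"
  have gv: "g v = x" and gf: "\<And>w. w \<in> set vs \<Longrightarrow> g w = f w" using v by (auto simp: g_def)
  have ne: "f w \<noteq> x" if "w \<in> set vs" for w
    using f(2)[OF that] by (auto simp: U'_def nbrs_def split: if_splits)
  have adj: "k {x, f w} = i" if "w \<in> set vs" "{v, w} \<in> E" for w
    using f(2)[OF that(1)] that(2) by (auto simp: U'_def nbrs_def)
  have "inj_on g (set (v # vs))"
    using f(1) ne gv gf v unfolding inj_on_def by (metis set_ConsD)
  moreover have "\<forall>u\<in>set (v # vs). g u \<in> U u"
  proof
    fix u assume "u \<in> set (v # vs)"
    then consider "u = v" | "u \<in> set vs" by auto
    then show "g u \<in> U u"
    proof cases
      case 1 then show ?thesis using x(1) gv by simp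
    next
      case 2 then show ?thesis using f(2)[of u] gf by (simp add: U'_def split: if_splits)
    qed
  qed
  moreover have "k {g u, g w} = i"
    if uw: "u \<in> set (v # vs)" "w \<in> set (v # vs)" "u \<noteq> w" "{u, w} \<in> E" for u w
  proof -
    consider "u = v" "w \<in> set vs" | "w = v" "u \<in> set vs" | "u \<in> set vs" "w \<in> set vs"
      using uw by auto
    then show ?thesis
    proof cases
      case 1 then show ?thesis using adj uw(4) gv gf by auto
    next
      case 2
      then have "k {x, f u} = i" using adj uw(4) by (simp add: insert_commute)
      then show ?thesis using 2 gv gf by (simp add: insert_commute)
    next
      case 3 then show ?thesis using monochromatic_onD[OF f(3)] uw gf by auto
    qed
  qed
  ultimately show ?case unfolding monochromatic_on_def by (intro exI[of _ g]) simp
qed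

text \<open>All candidate sets start as \<open>B\<close> itself. In a \<open>d\<close>-degenerate graph every candidate set is hit at
  most \<open>d\<close> times before its turn, hence the loss \<open>\<epsilon> ^ d\<close>; the factor \<open>s\<close> comes from the union of the bad
  sets.\<close>

lemma sparse_pair_if_no_copy:
  fixes \<epsilon> :: real
  assumes "0 < \<epsilon>" "\<epsilon> \<le> 1" "finite B" "finite S" "card S \<le> s" "1 \<le> s"
    and deg: "\<And>T. T \<subseteq> S \<Longrightarrow> T \<noteq> {} \<Longrightarrow> \<exists>v\<in>T. card {u\<in>T. {u, v} \<in> E} \<le> d"
    and no_copy: "\<not> mono_copy k i E S B"
    and large: "2 * real s \<le> \<epsilon> ^ d * real (card B)"
  shows "\<exists>X Y. X \<subseteq> B \<and> Y \<subseteq> B \<and>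
    \<epsilon> ^ d * real (card B) / (2 * real s) \<le> real (card X) \<and>
    \<epsilon> ^ d * real (card B) / (2 * real s) \<le> real (card Y) \<and> sparse_pair k i \<epsilon> X Y"
proof (rule ccontr)
  assume contra: "\<not> ?thesis"
  define m where "m = \<epsilon> ^ d * real (card B) / (2 * real s)"
  have no_sparse: "\<not> sparse_pair k i \<epsilon> X Y"
    if "X \<subseteq> B" "Y \<subseteq> B" "m \<le> card X" "m \<le> card Y" for X Y
    using that contra unfolding m_def by blast
  obtain vs where vs: "distinct vs" "set vs = S"
    "\<And>xs w ys. vs = xs @ w # ys \<Longrightarrow> card {u\<in>set xs. {u, w} \<in> E} \<le> d"
    using degenerate_ordering[OF \<open>finite S\<close> deg] by blast
  define M where "M = real s * m"
  have M: "M = \<epsilon> ^ d * real (card B) / 2" using \<open>1 \<le> s\<close> by (simp add: M_def m_def)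
  have "0 \<le> m" using assms(1) by (simp add: m_def)
  have len: "length vs \<le> s" using vs \<open>card S \<le> s\<close> distinct_card by metis
  have "\<exists>f. inj_on f (set vs) \<and> (\<forall>v\<in>set vs. f v \<in> B) \<and> monochromatic_on k i E f (set vs)"
  proof (rule embed_ordered[OF assms(1,2) no_sparse, where M = M and s = s and b = "\<lambda>_. d"])
    show "m \<le> M" using \<open>0 \<le> m\<close> \<open>1 \<le> s\<close> by (simp add: M_def mult_le_cancel_right1)
    show "0 \<le> M" using \<open>0 \<le> m\<close> by (simp add: M_def)
    show "M + real (length vs) \<le> \<epsilon> ^ d * real (card B)"
      using M large len by linarith
  qed (use vs len \<open>finite B\<close> in \<open>auto simp: M_def\<close>)
  then have "mono_copy k i E S B"
    unfolding mono_copy_def vs(2) by blast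
  then show False using no_copy by simp
qed

section \<open>Completing a pair to a copy\<close>

text \<open>The binomial theorem, sorted by the subset that contributes the factors \<open>z\<close>.\<close>

lemma sum_power_card_Pow:
  fixes z :: "'b :: comm_semiring_1"
  assumes "finite S"
  shows "(\<Sum>T\<in>Pow S. z ^ card T) = (1 + z) ^ card S"
  using assms
proof (induction S rule: finite_induct)
  case empty
  then show ?case by simp
next
  case (insert x S)
  have inj: "inj_on (insert x) (Pow S)" using insert.hyps(2) by (auto simp: inj_on_def)
  have disj: "Pow S \<inter> insert x ` Pow S = {}" using insert.hyps(2) by auto
  have "(\<Sum>T\<in>Pow (insert x S). z ^ card T)
      = (\<Sum>T\<in>Pow S. z ^ card T) + (\<Sum>T\<in>insert x ` Pow S. z ^ card T)"
    unfolding Pow_insert using insert.hyps(1) disj by (intro sum.union_disjoint) auto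
  also have "(\<Sum>T\<in>insert x ` Pow S. z ^ card T) = (\<Sum>T\<in>Pow S. z * z ^ card T)"
    unfolding sum.reindex[OF inj] o_def
  proof (rule sum.cong)
    fix T assume "T \<in> Pow S"
    then have "finite T" "x \<notin> T" using insert.hyps finite_subset by auto
    then show "z ^ card (insert x T) = z * z ^ card T" by simp
  qed simp
  finally show ?case using insert by (simp add: sum_distrib_left[symmetric] algebra_simps)
qed

text \<open>Each small subset has weight at least \<open>z powr q\<close> in the sum over all subsets. With \<open>z\<close> of the order
  of \<open>q / card S\<close> this is the usual entropy bound up to constants in the exponent.\<close>

lemma card_small_subsets_le:
  fixes z q :: real
  assumes "finite S" "0 < z" "z \<le> 1"
  shows "real (card {T. T \<subseteq> S \<and> real (card T) \<le> q}) \<le> z powr (-q) * (1 + z) ^ card S"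
proof -
  let ?F = "{T. T \<subseteq> S \<and> real (card T) \<le> q}"
  have "real (card ?F) * z powr q = (\<Sum>T\<in>?F. z powr q)" by simp
  also have "\<dots> \<le> (\<Sum>T\<in>?F. z ^ card T)"
  proof (rule sum_mono)
    fix T assume "T \<in> ?F"
    then have "z powr q \<le> z powr real (card T)" using assms(2,3) by (intro powr_mono') auto
    then show "z powr q \<le> z ^ card T" using assms(2) by (simp add: powr_realpow)
  qed
  also have "\<dots> \<le> (\<Sum>T\<in>Pow S. z ^ card T)"
    using assms by (intro sum_mono2) auto
  also have "\<dots> = (1 + z) ^ card S" using assms(1) by (rule sum_power_card_Pow)
  finally show ?thesis using assms(2) by (simp add: powr_minus field_simps)
qed

text \<open>On average a vertex of \<open>Y\<close> has at most \<open>\<epsilon> * card S\<close> neighbours of colour \<open>i\<close> in the image of \<open>S\<close>, so at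
  least half of \<open>Y\<close> has at most twice as many, and at least a quarter of \<open>Y\<close> does so
  outside the image. There are few possibilities for such an
  exceptional set of neighbours, and one of them is shared by a large \<open>Y'\<close>. Removing it from \<open>S\<close>
  leaves a part of the copy that is joined to all of \<open>Y'\<close> in the other colour.\<close>

lemma complete_to_most_of_copy:
  fixes \<epsilon> z :: real
  assumes "finite S" "finite Y" "inj_on f S" "f ` S \<subseteq> X" "sparse_pair k i \<epsilon> X Y"
    and "0 < \<epsilon>" "0 < z" "z \<le> 1" and Y: "4 * card S \<le> card Y"
  shows "\<exists>S' Y'. S' \<subseteq> S \<and> Y' \<subseteq> Y - f ` S \<and> (1 - 2 * \<epsilon>) * real (card S) \<le> real (card S') \<and>
     (\<forall>v\<in>S'. \<forall>y\<in>Y'. k {f v, y} = (\<not> i)) \<and>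
     real (card Y) / 4 \<le> real (card Y') * (z powr (- (2 * \<epsilon> * real (card S))) * (1 + z) ^ card S)"
proof -
  define q where "q = 2 * \<epsilon> * real (card S)"
  define bad where "bad y = {v\<in>S. k {f v, y} = i}" for y
  define Y1 where "Y1 = Y - f ` S"
  define Y0 where "Y0 = {y\<in>Y1. real (card (bad y)) \<le> q}"
  have fin: "finite Y1" "finite Y0" using assms(2) by (auto simp: Y1_def Y0_def)
  have sum_bad: "(\<Sum>y\<in>Y1. real (card (bad y))) \<le> real (card S) * (\<epsilon> * real (card Y))"
  proof -
    have "(\<Sum>y\<in>Y1. real (card (bad y))) = (\<Sum>y\<in>Y1. \<Sum>v\<in>S. of_bool (k {f v, y} = i))"
      using assms(1) by (simp add: bad_def Int_def)
    also have "\<dots> = (\<Sum>v\<in>S. \<Sum>y\<in>Y1. of_bool (k {f v, y} = i))" by (rule sum.swap)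
    also have "\<dots> \<le> (\<Sum>v\<in>S. \<epsilon> * real (card Y))"
    proof (rule sum_mono)
      fix v assume v: "v \<in> S"
      have "(\<Sum>y\<in>Y1. of_bool (k {f v, y} = i)) = real (card {y\<in>Y1. k {f v, y} = i})"
        using fin(1) by (simp add: Int_def)
      also have "\<dots> \<le> real (card (nbrs k i (f v) \<inter> Y))"
        using v assms(2) by (intro of_nat_mono card_mono) (auto simp: nbrs_def Y1_def)
      also have "\<dots> \<le> \<epsilon> * real (card Y)"
        using assms(4,5) v unfolding sparse_pair_def by (intro less_imp_le) auto
      finally show "(\<Sum>y\<in>Y1. of_bool (k {f v, y} = i)) \<le> \<epsilon> * real (card Y)" .
    qed
    finally show ?thesis by simp
  qed
  have "q * real (card (Y1 - Y0)) = (\<Sum>y\<in>Y1 - Y0. q)" by (simp only: sum_constant mult.commute)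
  also have "\<dots> \<le> (\<Sum>y\<in>Y1 - Y0. real (card (bad y)))"
    by (rule sum_mono) (auto simp: Y0_def)
  also have "\<dots> \<le> (\<Sum>y\<in>Y1. real (card (bad y)))"
    using fin by (intro sum_mono2) auto
  also have "\<dots> \<le> q * (real (card Y) / 2)" using sum_bad by (simp add: q_def field_simps)
  finally have q_le: "q * real (card (Y1 - Y0)) \<le> q * (real (card Y) / 2)" .
  have "real (card (Y1 - Y0)) \<le> real (card Y) / 2"
  proof (cases "card S = 0")
    case True
    then have "Y1 - Y0 = {}" using assms(1) by (auto simp: Y0_def q_def bad_def)
    then show ?thesis by (simp only: card.empty)
  next
    case False
    then have "0 < q" using assms(6) by (simp add: q_def)
    then show ?thesis using q_le by (metis mult_le_cancel_left_pos)
  qed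
  moreover have "card Y0 = card Y1 - card (Y1 - Y0)"
    using fin by (subst card_Diff_subset) (auto simp: Y0_def card_mono)
  moreover have "card Y - card S \<le> card Y1"
    using assms(1) diff_card_le_card_Diff[of "f ` S" Y] card_image_le[of S f]
    unfolding Y1_def by fastforce
  moreover have "card (Y1 - Y0) \<le> card Y1" using fin by (intro card_mono) auto
  ultimately have Y0: "real (card Y) / 4 \<le> real (card Y0)" using Y by linarith
  define F where "F = {T. T \<subseteq> S \<and> real (card T) \<le> q}"
  have "finite F" unfolding F_def using assms(1) by simp
  moreover have "{} \<in> F" using assms(6) by (simp add: F_def q_def)
  moreover have "bad \<in> Y0 \<rightarrow> F" by (auto simp: F_def Y0_def bad_def)
  ultimately obtain T where T: "T \<in> F" "card Y0 \<le> card (bad -` {T} \<inter> Y0) * card F"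
    using pigeonhole_card[of bad Y0 F] fin(2) by blast
  define S' Y' where "S' = S - T" and "Y' = bad -` {T} \<inter> Y0"
  have "card S' = card S - card T"
    using T(1) assms(1) finite_subset unfolding S'_def F_def by (intro card_Diff_subset) auto
  moreover have "card T \<le> card S" using T(1) assms(1) by (auto simp: F_def intro: card_mono)
  ultimately have "(1 - 2 * \<epsilon>) * real (card S) \<le> real (card S')"
    using T(1) by (simp add: F_def q_def algebra_simps of_nat_diff)
  moreover have "k {f v, y} = (\<not> i)" if "v \<in> S'" "y \<in> Y'" for v y
  proof -
    have "bad y = T" "v \<in> S" "v \<notin> T" using that by (auto simp: S'_def Y'_def)
    then have "k {f v, y} \<noteq> i" unfolding bad_def by blast
    then show ?thesis by blast
  qed
  moreover have "real (card Y) / 4 \<le> real (card Y') * (z powr (- q) * (1 + z) ^ card S)"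
  proof -
    have "real (card Y) / 4 \<le> real (card Y') * real (card F)"
      using Y0 T(2) unfolding Y'_def by (metis of_nat_le_iff of_nat_mult order_trans)
    also have "\<dots> \<le> real (card Y') * (z powr (- q) * (1 + z) ^ card S)"
      unfolding F_def using assms by (intro mult_left_mono card_small_subsets_le) auto
    finally show ?thesis .
  qed
  moreover have "S' \<subseteq> S" "Y' \<subseteq> Y - f ` S" by (auto simp: S'_def Y'_def Y0_def Y1_def)
  ultimately show ?thesis unfolding q_def by blast
qed

section \<open>Off-diagonal Ramsey numbers of cliques\<close>

definition mono_clique :: "('b set \<Rightarrow> bool) \<Rightarrow> bool \<Rightarrow> 'b set \<Rightarrow> bool" where
  "mono_clique k i Q \<longleftrightarrow> (\<forall>x\<in>Q. \<forall>y\<in>Q. x \<noteq> y \<longrightarrow> k {x, y} = i)"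

lemma mono_clique_insert:
  assumes "mono_clique k i Q" "Q \<subseteq> nbrs k i x"
  shows "mono_clique k i (insert x Q)"
  using assms unfolding mono_clique_def nbrs_def
  by (smt (verit) insert_commute insert_iff mem_Collect_eq subset_iff)

lemma mono_copy_if_mono_clique:
  assumes "mono_clique k i Q" "Q \<subseteq> B" "finite S" "finite Q" "card S \<le> card Q"
  shows "mono_copy k i E S B"
proof -
  obtain f where f: "f ` S \<subseteq> Q" "inj_on f S" using assms(3-5) card_le_inj by blast
  then have "monochromatic_on k i E f S"
    using assms(1) unfolding monochromatic_on_def mono_clique_def inj_on_def by blast
  then show ?thesis using f assms(2) unfolding mono_copy_def by blast
qed

text \<open>The recursion of Erdos and Szekeres, solved by a product instead of a binomial coefficient:
  with \<open>w = inverse (p True ^ n True * p False ^ n False)\<close>, the neighbourhoods of a point in the two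
  colours have sizes at most \<open>p True * w - 1\<close> and \<open>p False * w - 1\<close>, and the point itself makes
  up for one of the two units lost.\<close>

lemma erdos_szekeres_off_diagonal:
  fixes p :: "bool \<Rightarrow> real" and B :: "'b set"
  assumes "finite B" "\<And>i. 0 < p i" "p True + p False = 1"
    and "\<And>i Q. Q \<subseteq> B \<Longrightarrow> mono_clique k i Q \<Longrightarrow> card Q \<noteq> n i"
  shows "real (card B) + 1 \<le> inverse (p True ^ n True * p False ^ n False)"
  using assms(1,4)
proof (induction "n True + n False" arbitrary: n B)
  case 0
  from 0(3)[of "{}" True] 0(1) show ?case by (simp add: mono_clique_def)
next
  case (Suc m)
  have pos: "0 < n i" for i
    using Suc.prems(2)[of "{}" i] by (simp add: mono_clique_def)
  show ?case
  proof (cases "B = {}")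
    case True
    have "p True \<le> 1" "p False \<le> 1" using assms(2)[of True] assms(2)[of False] assms(3) by linarith+
    then have "p True ^ n True * p False ^ n False \<le> 1"
      using assms(2) by (intro mult_le_one power_le_one) (auto intro: less_imp_le)
    moreover have "0 < p True ^ n True * p False ^ n False" using assms(2) by simp
    ultimately have "1 \<le> inverse (p True ^ n True * p False ^ n False)" by (rule one_le_inverse[rotated])
    then show ?thesis unfolding True by simp
  next
    case False
    then obtain x where x: "x \<in> B" by blast
    define N where "N i = nbrs k i x \<inter> B" for i
    define w where "w = inverse (p True ^ n True * p False ^ n False)"
    have N: "real (card (N i)) + 1 \<le> p i * w" for i
    proof -
      define n' where "n' = n(i := n i - 1)"
      have "real (card (N i)) + 1 \<le> inverse (p True ^ n' True * p False ^ n' False)"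
      proof (rule Suc.hyps(1))
        show "m = n' True + n' False"
          using Suc.hyps(2) pos[of True] pos[of False] by (cases i) (auto simp: n'_def)
        show "finite (N i)" using Suc.prems(1) by (simp add: N_def)
        show "card Q \<noteq> n' j" if Q: "Q \<subseteq> N i" "mono_clique k j Q" for j Q
        proof (cases "j = i")
          case True
          have "mono_clique k i (insert x Q)"
            using Q True by (intro mono_clique_insert) (auto simp: N_def)
          then have "card (insert x Q) \<noteq> n i"
            using Q(1) x by (intro Suc.prems(2)) (auto simp: N_def)
          moreover have "x \<notin> Q" using Q(1) by (auto simp: N_def nbrs_def)
          moreover have "finite Q" using Q(1) Suc.prems(1) finite_subset by (auto simp: N_def)
          ultimately show ?thesis using True pos[of i] by (auto simp: n'_def)
        next
          case False
          then show ?thesis using Suc.prems(2)[of Q j] Q by (auto simp: n'_def N_def)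
        qed
      qed
      also have "\<dots> = p i * w"
      proof -
        have "p i ^ n i = p i * p i ^ (n i - 1)" using pos[of i] by (cases "n i") auto
        then show ?thesis using assms(2)[of i] by (cases i) (auto simp: n'_def w_def)
      qed
      finally show ?thesis .
    qed
    have "B = insert x (N True \<union> N False)" using x by (auto simp: N_def nbrs_def)
    moreover have "card (insert x (N True \<union> N False)) \<le> Suc (card (N True \<union> N False))"
      using Suc.prems(1) by (simp add: N_def card_insert_if)
    ultimately have "card B \<le> Suc (card (N True) + card (N False))"
      using card_Un_le[of "N True" "N False"] by simp
    then have "real (card B) + 1 \<le> p True * w + p False * w"
      using N[of True] N[of False] by linarith
    also have "\<dots> = w" using assms(3) by (metis distrib_right mult_1)
    finally show ?thesis unfolding w_def .
  qed
qed

section \<open>Graphs that are sparse on all vertex subsets\<close>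

lemma one_plus_le_two_powr:
  fixes x :: real
  assumes "0 \<le> x"
  shows "1 + x \<le> 2 powr (2 * x)"
proof -
  have "x * (1/2) \<le> x * ln 2" using ln2_ge_two_thirds assms by (intro mult_left_mono) auto
  then have "exp x \<le> 2 powr (2 * x)" by (simp add: powr_def)
  then show ?thesis using exp_ge_add_one_self[of x] by linarith
qed

text \<open>The second summand in the degree bound accounts for subsets that are too small for
  concentration of the number of edges. From subsets of \<open>\<rho> * t\<close> vertices on, the assumption
  \<open>log 2 t \<le> \<rho>\<^sup>2 * t\<close> makes it comparable to the first one.\<close>

locale locally_sparse_graph =
  fixes V :: "'a set" and E :: "'a set set" and t :: nat and \<rho> :: real
  assumes finV: "finite V" and cardV: "card V = t" and t4: "4 \<le> t"
    and \<rho>_pos: "0 < \<rho>" and \<rho>_le1: "\<rho> \<le> 1" and \<rho>_large: "log 2 (real t) \<le> \<rho>\<^sup>2 * real t"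
    and low_degree: "\<And>T. T \<subseteq> V \<Longrightarrow> T \<noteq> {} \<Longrightarrow>
      \<exists>v\<in>T. real (card {u\<in>T. {u, v} \<in> E}) \<le> 2 * \<rho> * real (card T) + 4 * log 2 (real t)"
begin

text \<open>The price of embedding \<open>s\<close> vertices will be a factor \<open>2 powr (O(L * s))\<close> in the size of the host set.\<close>

definition L :: real where "L = \<rho> * log 2 (2 / \<rho>)"

text \<open>Unless there is a monochromatic clique on \<open>t\<close> vertices, off-diagonal Ramsey numbers supply
  monochromatic cliques of this size in both colours, so subgraphs on
  at most this many vertices always have copies, and the degree bound is only applied at this
  scale and above.\<close>

definition min_scale :: nat where "min_scale = nat \<lceil>\<rho> * real t\<rceil>"

lemma log_ge_1: "1 \<le> log 2 (2 / \<rho>)"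
  using \<rho>_pos \<rho>_le1 by (simp add: le_log_iff field_simps)

lemma \<rho>_le_L: "\<rho> \<le> L"
  using mult_left_mono[OF log_ge_1, of \<rho>] \<rho>_pos by (simp add: L_def)

lemma log_t_ge_2: "2 \<le> log 2 (real t)"
  using t4 by (simp add: le_log_iff)

lemma min_scale_ge: "\<rho> * real t \<le> real min_scale"
  by (simp add: min_scale_def real_nat_ceiling_ge)

lemma \<rho>t_ge: "log 2 (real t) \<le> \<rho> * real t"
proof -
  have "\<rho>\<^sup>2 * real t \<le> \<rho> * real t"
    using \<rho>_pos \<rho>_le1 by (intro mult_right_mono) (auto simp: power2_eq_square mult_le_cancel_left1)
  then show ?thesis using \<rho>_large by linarith
qed

lemma min_scale_ge_2: "2 \<le> min_scale"
  using min_scale_ge \<rho>t_ge log_t_ge_2 by linarith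

lemma min_scale_le: "real min_scale \<le> 2 * \<rho> * real t"
proof -
  have "real min_scale < \<rho> * real t + 1"
    using \<rho>_pos ceiling_correct[of "\<rho> * real t"] unfolding min_scale_def by simp
  then show ?thesis using \<rho>t_ge log_t_ge_2 by linarith
qed

lemma log_t_le:
  assumes "min_scale \<le> \<mu>"
  shows "log 2 (real t) \<le> \<rho> * real \<mu>" "log 2 (real t) \<le> L * real \<mu>"
proof -
  have "\<rho> * (\<rho> * real t) \<le> \<rho> * real \<mu>"
    using min_scale_ge assms \<rho>_pos by (intro mult_left_mono) auto
  then show *: "log 2 (real t) \<le> \<rho> * real \<mu>" using \<rho>_large by (simp add: power2_eq_square)
  have "\<rho> * real \<mu> \<le> L * real \<mu>" using \<rho>_le_L by (intro mult_right_mono) auto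
  with * show "log 2 (real t) \<le> L * real \<mu>" by linarith
qed

lemma two_over_\<rho>_powr: "(2 / \<rho>) powr x = 2 powr (log 2 (2 / \<rho>) * x)"
  using \<rho>_pos by (simp add: powr_powr[symmetric])

text \<open>The Ramsey number of a clique on \<open>min_scale\<close> vertices against one on \<open>t\<close> vertices is \<open>2 powr O(L * t)\<close>.
  So without a monochromatic clique on \<open>t\<close> vertices there are cliques on \<open>min_scale\<close> vertices in both
  colours.\<close>

lemma small_copies_or_full_copy:
  assumes "finite B" and B: "2 powr (4 * L * real t) \<le> real (card B)"
  shows "(\<exists>i. mono_copy k i E V B) \<or> (\<forall>i S. finite S \<longrightarrow> card S \<le> min_scale \<longrightarrow> mono_copy k i E S B)"
proof (rule ccontr)
  assume "\<not> ?thesis"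
  then obtain i S where none: "\<And>j. \<not> mono_copy k j E V B"
    and S: "finite S" "card S \<le> min_scale" "\<not> mono_copy k i E S B" by blast
  define n where "n j = (if j = i then min_scale else t)" for j
  \<comment> \<open>A monochromatic clique on \<open>t\<close> vertices is about \<open>1 / \<rho>\<close> times larger than one
    on \<open>min_scale\<close> vertices, so its colour gets almost all of the weight.\<close>
  define p where "p j = (if j = i then \<rho> / 2 else 1 - \<rho> / 2)" for j
  have "card Q \<noteq> n j" if Q: "Q \<subseteq> B" "mono_clique k j Q" for j Q
  proof
    assume card: "card Q = n j"
    have "finite Q" using Q(1) assms(1) finite_subset by blast
    then have copy: "card S \<le> card Q \<Longrightarrow> mono_copy k j E S B" "card V \<le> card Q \<Longrightarrow> mono_copy k j E V B"
      using mono_copy_if_mono_clique[OF Q(2,1)] S(1) finV by blast+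
    show False
    proof (cases "j = i")
      case True
      then show ?thesis using copy(1) S card by (simp add: n_def)
    next
      case False
      then show ?thesis using copy(2) none card cardV by (simp add: n_def)
    qed
  qed
  then have "real (card B) + 1 \<le> inverse (p True ^ n True * p False ^ n False)"
    using \<rho>_pos \<rho>_le1 assms(1)
    by (intro erdos_szekeres_off_diagonal) (auto simp: p_def)
  also have "p True ^ n True * p False ^ n False = (\<rho> / 2) ^ min_scale * (1 - \<rho> / 2) ^ t"
    by (cases i) (auto simp: p_def n_def)
  also have "inverse \<dots> = (2 / \<rho>) powr real min_scale * inverse (1 - \<rho> / 2) ^ t"
    using \<rho>_pos by (simp add: powr_realpow power_inverse[symmetric] field_simps)
  also have "\<dots> \<le> 2 powr (2 * L * real t) * 2 powr (2 * L * real t)"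
  proof (rule mult_mono)
    have "log 2 (2 / \<rho>) * real min_scale \<le> log 2 (2 / \<rho>) * (2 * \<rho> * real t)"
      using min_scale_le log_ge_1 by (intro mult_left_mono) auto
    then show "(2 / \<rho>) powr real min_scale \<le> 2 powr (2 * L * real t)"
      unfolding two_over_\<rho>_powr by (simp add: L_def algebra_simps)
    have "1 \<le> (1 + \<rho>) * (1 - \<rho> / 2)"
      using \<rho>_pos \<rho>_le1 mult_left_mono[of \<rho> 1 \<rho>] by (simp add: algebra_simps)
    then have "inverse (1 - \<rho> / 2) \<le> 1 + \<rho>"
      using \<rho>_le1 by (simp add: field_simps)
    also have "\<dots> \<le> 2 powr (2 * \<rho>)" using \<rho>_pos by (intro one_plus_le_two_powr) auto
    also have "\<dots> \<le> 2 powr (2 * L)" using \<rho>_le_L by simp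
    finally have "inverse (1 - \<rho> / 2) ^ t \<le> (2 powr (2 * L)) ^ t"
      using \<rho>_le1 by (intro power_mono) auto
    then show "inverse (1 - \<rho> / 2) ^ t \<le> 2 powr (2 * L * real t)"
      by (simp add: powr_realpow[symmetric] powr_powr)
  qed (use \<rho>_le1 in auto)
  also have "\<dots> = 2 powr (4 * L * real t)" by (simp add: powr_add[symmetric] mult_ac)
  finally show False using B by linarith
qed

text \<open>At a scale \<open>\<mu> \<ge> min_scale\<close> the subgraphs on at most \<open>\<mu>\<close> vertices are \<open>O(\<rho> * \<mu>)\<close>-degenerate, so the loss
  \<open>(\<rho> / 4) ^ d\<close> of the greedy embedding is \<open>2 powr (- O(L * \<mu>))\<close>. Density \<open>\<rho> / 4\<close> is small enough for
  the exceptional sets in the next lemma to cost no more than that.\<close>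

lemma sparse_pair_if_no_small_copy:
  assumes "finite B" "min_scale \<le> \<mu>" "S \<subseteq> V" "card S \<le> \<mu>" "\<not> mono_copy k i E S B"
    and B: "2 powr (14 * L * real \<mu>) \<le> real (card B)"
  shows "\<exists>X Y. X \<subseteq> B \<and> Y \<subseteq> B \<and> 2 powr (- 14 * L * real \<mu>) * real (card B) \<le> real (card X) \<and>
    2 powr (- 14 * L * real \<mu>) * real (card B) \<le> real (card Y) \<and> sparse_pair k i (\<rho> / 4) X Y"
proof -
  define d where "d = nat \<lfloor>6 * \<rho> * real \<mu>\<rfloor>"
  define x where "x = L * real \<mu>"
  have d: "real d \<le> 6 * \<rho> * real \<mu>" using \<rho>_pos by (simp add: d_def)
  have finS: "finite S" and St: "card S \<le> t"
    using assms(3) finV cardV finite_subset card_mono by blast+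
  have x: "log 2 (real t) \<le> x" "2 \<le> x"
    using log_t_le(2)[OF assms(2)] log_t_ge_2 by (simp_all add: x_def)
  have deg: "\<exists>v\<in>T. card {u\<in>T. {u, v} \<in> E} \<le> d" if T: "T \<subseteq> S" "T \<noteq> {}" for T
  proof -
    obtain v where v: "v \<in> T" "real (card {u\<in>T. {u, v} \<in> E}) \<le> 2 * \<rho> * real (card T) + 4 * log 2 (real t)"
      using low_degree[of T] T assms(3) by blast
    have "card T \<le> \<mu>" using card_mono[OF finS T(1)] assms(4) by linarith
    then have "\<rho> * real (card T) \<le> \<rho> * real \<mu>" using \<rho>_pos by (intro mult_left_mono) auto
    then have "real (card {u\<in>T. {u, v} \<in> E}) \<le> 6 * \<rho> * real \<mu>"
      using v(2) log_t_le(1)[OF assms(2)] by linarith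
    then have "card {u\<in>T. {u, v} \<in> E} \<le> d" unfolding d_def by (simp add: le_nat_floor)
    then show ?thesis using v(1) by blast
  qed
  have pow: "2 powr (- 12 * x) \<le> (\<rho> / 4) ^ d"
  proof -
    have "log 2 (4 / \<rho>) = 1 + log 2 (2 / \<rho>)"
      using \<rho>_pos log_mult[of 2 "2 / \<rho>" 2] by simp
    then have log4: "log 2 (4 / \<rho>) \<le> 2 * log 2 (2 / \<rho>)" "0 \<le> log 2 (4 / \<rho>)" using log_ge_1 by linarith+
    have "real d * log 2 (4 / \<rho>) \<le> (6 * \<rho> * real \<mu>) * (2 * log 2 (2 / \<rho>))"
      using d log4 \<rho>_pos by (intro mult_mono) auto
    also have "\<dots> = 12 * x" by (simp add: x_def L_def)
    finally have le: "- 12 * x \<le> - (real d * log 2 (4 / \<rho>))" by simp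
    have "(\<rho> / 4) ^ d = (4 / \<rho>) powr (- real d)"
      using \<rho>_pos by (simp add: powr_minus powr_realpow power_divide field_simps)
    also have "\<dots> = 2 powr (- (real d * log 2 (4 / \<rho>)))"
      using \<rho>_pos by (simp add: powr_def log_def)
    finally show ?thesis using le by simp
  qed
  have t2: "2 * real t \<le> 2 powr (2 * x)"
  proof -
    have "2 * real t = 2 powr (1 + log 2 (real t))" using t4 by (simp add: powr_add)
    also have "\<dots> \<le> 2 powr (2 * x)" using x by simp
    finally show ?thesis .
  qed
  have B': "2 powr (- 12 * x) * real (card B) \<le> (\<rho> / 4) ^ d * real (card B)"
    using pow by (intro mult_right_mono) auto
  have "2 * real t \<le> 2 powr (- 12 * x) * 2 powr (14 * x)" using t2 by (simp add: powr_add[symmetric])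
  also have "\<dots> \<le> 2 powr (- 12 * x) * real (card B)"
    using B by (intro mult_left_mono) (auto simp: x_def mult.assoc)
  also note B'
  finally have large: "2 * real t \<le> (\<rho> / 4) ^ d * real (card B)" .
  have "2 powr (- 14 * x) * real (card B) = 2 powr (- 12 * x) * real (card B) / 2 powr (2 * x)"
    using powr_diff[of 2 "- 12 * x" "2 * x"] by simp
  also have "\<dots> \<le> (\<rho> / 4) ^ d * real (card B) / (2 * real t)"
    using B' t2 t4 \<rho>_pos by (intro frac_le) auto
  finally have size: "2 powr (- 14 * x) * real (card B) \<le> (\<rho> / 4) ^ d * real (card B) / (2 * real t)" .
  have eps: "0 < \<rho> / 4" "\<rho> / 4 \<le> 1" and "1 \<le> t" using \<rho>_pos \<rho>_le1 t4 by auto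
  obtain X Y where "X \<subseteq> B" "Y \<subseteq> B" "sparse_pair k i (\<rho> / 4) X Y"
    and XY: "(\<rho> / 4) ^ d * real (card B) / (2 * real t) \<le> real (card X)"
      "(\<rho> / 4) ^ d * real (card B) / (2 * real t) \<le> real (card Y)"
    using sparse_pair_if_no_copy[OF eps assms(1) finS St \<open>1 \<le> t\<close> deg assms(5) large] by metis
  moreover have "2 powr (- 14 * L * real \<mu>) * real (card B) = 2 powr (- 14 * x) * real (card B)"
    by (simp add: x_def mult.assoc)
  ultimately show ?thesis
    using order_trans[OF size XY(1)] order_trans[OF size XY(2)] by metis
qed

text \<open>Specialisation of the completion lemma to \<open>\<epsilon> = \<rho> / 4\<close> and \<open>z = \<rho> / 2\<close>: the number of exceptional sets
  is \<open>2 powr O(L * \<mu>)\<close>, and at least half of the copy survives because \<open>2 * \<epsilon> \<le> 1 / 2\<close>.\<close>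

lemma complete_to_half_of_copy:
  assumes "S \<subseteq> V" "card S \<le> \<mu>" "min_scale \<le> \<mu>" "finite Y" "inj_on f S" "f ` S \<subseteq> X"
    and sparse: "sparse_pair k i (\<rho> / 4) X Y" and Y: "4 * t \<le> card Y"
  shows "\<exists>S' Y'. S' \<subseteq> S \<and> Y' \<subseteq> Y - f ` S \<and> real (card S) / 2 \<le> real (card S') \<and>
     (\<forall>v\<in>S'. \<forall>y\<in>Y'. k {f v, y} = (\<not> i)) \<and>
     2 powr (- 4 * L * real \<mu>) * real (card Y) \<le> real (card Y')"
proof -
  define s where "s = real (card S)"
  define x where "x = L * real \<mu>"
  have finS: "finite S" and St: "card S \<le> t"
    using assms(1) finV cardV finite_subset card_mono by blast+
  have x: "2 \<le> x" using log_t_le(2)[OF assms(3)] log_t_ge_2 by (simp add: x_def)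
  have Ls: "L * s \<le> x" "\<rho> * s \<le> x"
  proof -
    show "L * s \<le> x"
      unfolding x_def s_def using assms(2) \<rho>_le_L \<rho>_pos by (intro mult_left_mono) auto
    moreover have "\<rho> * s \<le> L * s" using \<rho>_le_L by (intro mult_right_mono) (auto simp: s_def)
    ultimately show "\<rho> * s \<le> x" by linarith
  qed
  obtain S' Y' where S': "S' \<subseteq> S" "(1 - 2 * (\<rho> / 4)) * s \<le> real (card S')"
    and Y': "Y' \<subseteq> Y - f ` S" "\<forall>v\<in>S'. \<forall>y\<in>Y'. k {f v, y} = (\<not> i)"
    and size: "real (card Y) / 4 \<le> real (card Y') * ((\<rho> / 2) powr (- (2 * (\<rho> / 4) * s)) * (1 + \<rho> / 2) ^ card S)"
    using complete_to_most_of_copy[OF finS assms(4,5,6) sparse, where z = "\<rho> / 2"] \<rho>_pos \<rho>_le1 St Y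
    unfolding s_def by auto
  have "1 / 2 * s \<le> (1 - 2 * (\<rho> / 4)) * s"
    using \<rho>_le1 by (intro mult_right_mono) (auto simp: s_def)
  then have half: "s / 2 \<le> real (card S')" using S'(2) by linarith
  have "(\<rho> / 2) powr (- (2 * (\<rho> / 4) * s)) = (2 / \<rho>) powr (\<rho> / 2 * s)"
    using \<rho>_pos by (simp add: powr_minus powr_divide field_simps)
  also have "\<dots> = 2 powr (L * s / 2)" unfolding two_over_\<rho>_powr by (simp add: L_def mult_ac)
  finally have 1: "(\<rho> / 2) powr (- (2 * (\<rho> / 4) * s)) \<le> 2 powr x"
    using Ls(1) x by simp
  have "(1 + \<rho> / 2) ^ card S \<le> (2 powr (2 * (\<rho> / 2))) ^ card S"
    using \<rho>_pos by (intro power_mono one_plus_le_two_powr) auto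
  also have "\<dots> = 2 powr (\<rho> * s)" by (simp add: powr_realpow[symmetric] powr_powr s_def)
  finally have 2: "(1 + \<rho> / 2) ^ card S \<le> 2 powr x" using Ls(2) by (smt (verit) powr_mono)
  have "(4::real) = 2 powr 2" by simp
  also have "\<dots> \<le> 2 powr x" using x by (intro powr_mono) auto
  finally have 4: "4 \<le> 2 powr x" .
  have "real (card Y) \<le> 4 * (real (card Y') * ((\<rho> / 2) powr (- (2 * (\<rho> / 4) * s)) * (1 + \<rho> / 2) ^ card S))"
    using size by simp
  also have "\<dots> \<le> (2 powr x) * (2 powr x) * (real (card Y') * (2 powr x * 2 powr x))"
    using 1 2 4 x \<rho>_pos mult_mono[OF 4, of 1 "2 powr x"] by (intro mult_mono mult_nonneg_nonneg) (auto simp: ge_one_powr_ge_zero)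
  also have "\<dots> = real (card Y') * 2 powr (4 * x)"
    by (simp add: powr_add[symmetric])
  finally have "2 powr (- 4 * x) * real (card Y) \<le> 2 powr (- 4 * x) * (real (card Y') * 2 powr (4 * x))"
    by (intro mult_left_mono) auto
  also have "\<dots> = real (card Y')" by (simp add: powr_minus)
  finally have "2 powr (- 4 * L * real \<mu>) * real (card Y) \<le> real (card Y')"
    by (simp add: x_def mult.assoc)
  then show ?thesis using S'(1) Y' half unfolding s_def by blast
qed

text \<open>The heart of the proof. \<open>R j\<close> is the set of vertices still to be embedded in colour \<open>j\<close>, and \<open>\<mu>\<close> is a
  scale at which some subgraph is known to have no copy in \<open>B\<close> in some colour \<open>i\<close>. This yields
  \<open>X\<close> and \<open>Y\<close> with few edges of colour \<open>i\<close> between them, at a price of \<open>2 powr O(L * \<mu>)\<close>.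
  If some subgraph on at most \<open>\<mu> / 2\<close> vertices has no copy in \<open>X\<close> in some colour, the scale is halved
  and the argument continues in \<open>X\<close>. Otherwise either all of \<open>R (\<not> i)\<close> is small enough to have a copy
  in \<open>X\<close>, or \<open>\<mu> / 2\<close> of its vertices have a copy of colour \<open>\<not> i\<close> there; then half of them are joined completely to a large part of \<open>Y\<close>, and the argument
  continues there with fewer vertices to embed. A set without a copy at scale \<open>\<mu>\<close> passes
  this property on to its subsets, so the scale never grows: the halving steps cost a
  geometric series, the embedding steps cost \<open>O(L)\<close> per embedded vertex. Both are paid for by the
  potential \<open>card (R True) + card (R False) + 2 * \<mu>\<close>. The summand \<open>4 * L * t\<close> keeps the sets
  so large that copies at scale \<open>min_scale\<close> exist.\<close>

lemma mono_copy_of_remainder: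
  assumes "finite B" "\<And>j. R j \<subseteq> V" "min_scale \<le> \<mu>" "S \<subseteq> V" "card S \<le> \<mu>" "\<not> mono_copy k i E S B"
    and "2 powr (4 * L * real t + 160 * L * real (card (R True) + card (R False) + 2 * \<mu>)) \<le> real (card B)"
  shows "\<exists>j. mono_copy k j E (R j) B"
  using assms
proof (induction "card (R True) + card (R False) + \<mu>" arbitrary: R \<mu> S i B rule: less_induct)
  case less
  define size where "size R \<mu> = 4 * L * real t + 160 * L * real (card (R True) + card (R False) + 2 * \<mu>)"
    for R :: "bool \<Rightarrow> 'a set" and \<mu>
  have L0: "0 \<le> L" using \<rho>_le_L \<rho>_pos by linarith
  have \<mu>2: "2 \<le> \<mu>" using less.prems(3) min_scale_ge_2 by linarith
  have B: "2 powr (size R \<mu>) \<le> real (card B)" using less.prems(7) unfolding size_def .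
  have Lt: "log 2 (real t) \<le> L * real t" "0 \<le> L * real t"
    using \<rho>t_ge mult_right_mono[OF \<rho>_le_L, of "real t"] log_t_ge_2 by simp_all
  have size_ge: "4 * L * real t + 320 * L * real \<mu> \<le> size R \<mu>"
    using L0 by (simp add: size_def algebra_simps)
  have "14 * L * real \<mu> \<le> size R \<mu>" using size_ge Lt(2) mult_nonneg_nonneg[OF L0, of "real \<mu>"] by linarith
  then have "2 powr (14 * L * real \<mu>) \<le> real (card B)"
    using B by (smt (verit) powr_mono)
  then obtain X Y where XY: "X \<subseteq> B" "Y \<subseteq> B" "sparse_pair k i (\<rho> / 4) X Y"
    "2 powr (- 14 * L * real \<mu>) * real (card B) \<le> real (card X)"
    "2 powr (- 14 * L * real \<mu>) * real (card B) \<le> real (card Y)"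
    using sparse_pair_if_no_small_copy[OF less.prems(1,3-6)] by blast
  have "2 powr (size R \<mu> - 14 * L * real \<mu>) = 2 powr (- 14 * L * real \<mu>) * 2 powr size R \<mu>"
    by (simp add: powr_add[symmetric])
  also have "\<dots> \<le> 2 powr (- 14 * L * real \<mu>) * real (card B)"
    using B by (intro mult_left_mono) auto
  finally have sizeXY: "2 powr (size R \<mu> - 14 * L * real \<mu>) \<le> real (card X)"
      "2 powr (size R \<mu> - 14 * L * real \<mu>) \<le> real (card Y)"
    using XY(4,5) by linarith+
  have finX: "finite X" and finY: "finite Y" using XY(1,2) less.prems(1) finite_subset by blast+
  show ?case
  proof (cases "\<exists>S1 i1. S1 \<subseteq> V \<and> card S1 \<le> \<mu> div 2 \<and> \<not> mono_copy k i1 E S1 X")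
    case True
    then obtain S1 i1 where S1: "S1 \<subseteq> V" "card S1 \<le> \<mu> div 2" "\<not> mono_copy k i1 E S1 X" by blast
    have "\<exists>j. mono_copy k j E (R j) X"
    proof (cases "min_scale \<le> \<mu> div 2")
      case True
      show ?thesis
      proof (rule less.hyps[where \<mu> = "\<mu> div 2", OF _ finX less.prems(2) True S1])
        show "card (R True) + card (R False) + \<mu> div 2 < card (R True) + card (R False) + \<mu>"
          using \<mu>2 by simp
        have "real (\<mu> div 2) \<le> real \<mu> / 2" by linarith
        then have "L * real (\<mu> div 2) \<le> L * (real \<mu> / 2)" using L0 by (intro mult_left_mono) auto
        moreover have "size R (\<mu> div 2) = size R \<mu> - 320 * (L * real \<mu>) + 320 * (L * real (\<mu> div 2))"
          by (simp add: size_def algebra_simps)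
        ultimately have "size R (\<mu> div 2) \<le> size R \<mu> - 14 * L * real \<mu>"
          using mult_nonneg_nonneg[OF L0, of "real \<mu>"] by linarith
        then have "2 powr size R (\<mu> div 2) \<le> real (card X)"
          using sizeXY(1) by (smt (verit) powr_mono)
        then show "2 powr (4 * L * real t + 160 * L * real (card (R True) + card (R False) + 2 * (\<mu> div 2)))
            \<le> real (card X)"
          unfolding size_def .
      qed
    next
      case False
      have "4 * L * real t \<le> size R \<mu> - 14 * L * real \<mu>"
        using size_ge mult_nonneg_nonneg[OF L0, of "real \<mu>"] by linarith
      then have "2 powr (4 * L * real t) \<le> real (card X)"
        using sizeXY(1) by (smt (verit) powr_mono)
      from small_copies_or_full_copy[OF finX this, of k] show ?thesis
      proof
        assume "\<exists>j. mono_copy k j E V X"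
        then show ?thesis using mono_copy_mono less.prems(2) by blast
      next
        assume "\<forall>j S. finite S \<longrightarrow> card S \<le> min_scale \<longrightarrow> mono_copy k j E S X"
        moreover have "finite S1" using S1(1) finV finite_subset by blast
        moreover have "card S1 \<le> min_scale" using S1(2) False by linarith
        ultimately show ?thesis using S1(3) by blast
      qed
    qed
    then show ?thesis using mono_copy_mono XY(1) by blast
  next
    case False
    then have small: "mono_copy k j E T X" if "T \<subseteq> V" "card T \<le> \<mu> div 2" for T j
      using that by blast
    show ?thesis
    proof (cases "card (R (\<not> i)) \<le> \<mu> div 2")
      case True
      then have "mono_copy k (\<not> i) E (R (\<not> i)) X" using small less.prems(2) by blast
      then show ?thesis using mono_copy_mono XY(1) by blast
    next
      case False
      then obtain T where T: "T \<subseteq> R (\<not> i)" "card T = \<mu> div 2" "finite T"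
        using obtain_subset_with_card_n[of "\<mu> div 2" "R (\<not> i)"] by auto
      have TV: "T \<subseteq> V" using T(1) less.prems(2) by blast
      obtain f where f: "inj_on f T" "f ` T \<subseteq> X" "monochromatic_on k (\<not> i) E f T"
        using small[OF TV, of "\<not> i"] T(2) unfolding mono_copy_def by auto
      have "4 * t \<le> card Y"
      proof -
        have "4 * real t = 2 powr (2 + log 2 (real t))" using t4 by (simp add: powr_add)
        also have "\<dots> \<le> 2 powr (size R \<mu> - 14 * L * real \<mu>)"
          using size_ge mult_nonneg_nonneg[OF L0, of "real \<mu>"] Lt log_t_ge_2 by (intro powr_mono) linarith+
        finally have "real (4 * t) \<le> real (card Y)" using sizeXY(2) by simp
        then show ?thesis by (simp only: of_nat_le_iff)
      qed
      then obtain T' Y' where T': "T' \<subseteq> T" "real (card T) / 2 \<le> real (card T')"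
        and Y': "Y' \<subseteq> Y - f ` T" "\<forall>v\<in>T'. \<forall>y\<in>Y'. k {f v, y} = (\<not> i)"
          "2 powr (- 4 * L * real \<mu>) * real (card Y) \<le> real (card Y')"
        using complete_to_half_of_copy[OF TV _ less.prems(3) finY f(1,2) XY(3)] T(2) by auto
      have "real \<mu> / 4 \<le> real (\<mu> div 2)" using \<mu>2 by linarith
      then have cardT': "real \<mu> / 8 \<le> real (card T')" using T'(2) T(2) by linarith
      define R' where "R' = R((\<not> i) := R (\<not> i) - T')"
      have finT': "finite T'" using T'(1) T(3) finite_subset by blast
      have finR: "finite (R j)" for j using less.prems(2) finV finite_subset by blast
      have T'R: "T' \<subseteq> R (\<not> i)" using T'(1) T(1) by blast
      have "card (R (\<not> i) - T') + card T' = card (R (\<not> i))"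
        using finT' finR T'R by (simp add: card_Diff_subset card_mono)
      then have cardR': "card (R' True) + card (R' False) + card T' = card (R True) + card (R False)"
        by (cases i) (auto simp: R'_def)
      have "\<exists>j. mono_copy k j E (R' j) Y'"
      proof (rule less.hyps[where \<mu> = \<mu> and S = S and i = i])
        have "0 < real \<mu> / 8" using \<mu>2 by simp
        then have "0 < card T'" using cardT' by linarith
        then show "card (R' True) + card (R' False) + \<mu> < card (R True) + card (R False) + \<mu>"
          using cardR' by linarith
        show "finite Y'" using Y'(1) finY finite_subset by blast
        show "R' j \<subseteq> V" for j using less.prems(2) by (auto simp: R'_def)
        show "\<not> mono_copy k i E S Y'"
          using less.prems(6) mono_copy_mono Y'(1) XY(2) by (metis Diff_subset order_refl order_trans)
        have "L * real \<mu> \<le> 8 * (L * real (card T'))"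
          using mult_left_mono[OF cardT' L0] by simp
        moreover have r: "real (card (R' True) + card (R' False) + 2 * \<mu>)
            = real (card (R True) + card (R False) + 2 * \<mu>) - real (card T')"
          using cardR' by linarith
        \<comment> \<open>An embedding step costs \<open>14 + 4\<close> units \<open>L * \<mu>\<close> and gains at least
          \<open>\<mu> / 8\<close> vertices, worth \<open>160 / 8 = 20\<close> units.\<close>
        have "size R' \<mu> = size R \<mu> - 160 * (L * real (card T'))"
          unfolding size_def r right_diff_distrib by simp
        ultimately have "size R' \<mu> \<le> size R \<mu> - 18 * L * real \<mu>"
          using mult_nonneg_nonneg[OF L0, of "real \<mu>"] by linarith
        then have "2 powr size R' \<mu> \<le> 2 powr (- 4 * L * real \<mu> + (size R \<mu> - 14 * L * real \<mu>))"
          by (intro powr_mono) linarith+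
        also have "\<dots> = 2 powr (- 4 * L * real \<mu>) * 2 powr (size R \<mu> - 14 * L * real \<mu>)"
          by (rule powr_add)
        also have "\<dots> \<le> 2 powr (- 4 * L * real \<mu>) * real (card Y)"
          using sizeXY(2) by (intro mult_left_mono) auto
        also note Y'(3)
        finally show "2 powr (4 * L * real t + 160 * L * real (card (R' True) + card (R' False) + 2 * \<mu>))
            \<le> real (card Y')"
          unfolding size_def .
      qed (use less.prems in auto)
      then obtain j where j: "mono_copy k j E (R' j) Y'" by blast
      show ?thesis
      proof (cases "j = i")
        case True
        then have "mono_copy k i E (R i) Y'" using j by (simp add: R'_def)
        then show ?thesis using mono_copy_mono Y'(1) XY(2) by (metis Diff_subset order_refl order_trans)
      next
        case False
        then have "j = (\<not> i)" by blast
        then have copy: "mono_copy k (\<not> i) E (R (\<not> i) - T') Y'" using j by (simp add: R'_def)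
        have "mono_copy k (\<not> i) E (T' \<union> (R (\<not> i) - T')) B"
        proof (rule mono_copy_join[OF _ _ _ copy])
          show "inj_on f T'" using f(1) T'(1) inj_on_subset by blast
          show "f ` T' \<subseteq> B" using f(2) T'(1) XY(1) by blast
          show "monochromatic_on k (\<not> i) E f T'" using f(3) T'(1) by (rule monochromatic_on_subset)
          show "Y' \<subseteq> B - f ` T'" using Y'(1) XY(2) T'(1) by blast
        qed (use Y'(2) in simp)
        then show ?thesis using T'R by (metis Diff_partition)
      qed
    qed
  qed
qed

text \<open>Nothing is embedded at the beginning, and the whole graph witnesses the scale \<open>t\<close>: the potential is
  \<open>4 * t\<close>, and \<open>644 = 4 + 160 * 4\<close>.\<close>

lemma mono_copy_in_large_set:
  assumes "finite B" "2 powr (644 * L * real t) \<le> real (card B)"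
  shows "\<exists>i. mono_copy k i E V B"
proof (rule ccontr)
  assume none: "\<not> ?thesis"
  have "min_scale \<le> t"
    using mult_right_mono[OF \<rho>_le1, of "real t"] by (simp add: min_scale_def nat_le_iff ceiling_le_iff)
  then have "\<exists>j. mono_copy k j E ((\<lambda>_. V) j) B"
    using none assms cardV
    by (intro mono_copy_of_remainder[where S = V and \<mu> = t and i = True]) (auto simp: algebra_simps)
  then show False using none by blast
qed

end

section \<open>From large sets to Ramsey numbers\<close>

lemma ramsey_number_le:
  assumes "finite_simple_graph H" and n: "1 \<le> n"
    and copy: "\<And>k B. finite (B :: nat set) \<Longrightarrow> n \<le> real (card B) \<Longrightarrow> \<exists>i. mono_copy k i (edges H) (verts H) B"
  shows "real (ramsey_number H) \<le> 2 * n"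
proof -
  have "ramsey_arrows (nat \<lceil>n\<rceil>) H"
    unfolding ramsey_arrows_def
  proof
    fix k :: "nat set \<Rightarrow> bool"
    obtain i where "mono_copy k i (edges H) (verts H) {..<nat \<lceil>n\<rceil>}"
      using copy[of "{..<nat \<lceil>n\<rceil>}" k] real_nat_ceiling_ge[of n] by auto
    then obtain f where f: "inj_on f (verts H)" "f ` verts H \<subseteq> {..<nat \<lceil>n\<rceil>}"
      "monochromatic_on k i (edges H) f (verts H)" unfolding mono_copy_def by blast
    have "f ` e \<in> edges (colour_class (nat \<lceil>n\<rceil>) k i)" if e: "e \<in> edges H" for e
    proof -
      have "e \<in> nsets (verts H) 2" using e assms(1) by (auto simp: finite_simple_graph_def)
      then obtain u v where uv: "e = {u, v}" "u \<in> verts H" "v \<in> verts H" "u \<noteq> v"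
        by (rule nsets2_E)
      have "k {f u, f v} = i" using monochromatic_onD[OF f(3) uv(2-4)] e uv(1) by simp
      moreover have "f u \<noteq> f v" using f(1) uv by (auto simp: inj_on_def)
      moreover have "f u < nat \<lceil>n\<rceil>" "f v < nat \<lceil>n\<rceil>" using f(2) uv(2,3) by auto
      ultimately show ?thesis using uv(1) by (simp add: colour_class_def)
    qed
    then have "contains_copy (colour_class (nat \<lceil>n\<rceil>) k i) H"
      using f(1,2) unfolding contains_copy_def by (intro exI[of _ f]) (auto simp: colour_class_def)
    then show "\<exists>i. contains_copy (colour_class (nat \<lceil>n\<rceil>) k i) H" ..
  qed
  then have "ramsey_number H \<le> nat \<lceil>n\<rceil>"
    unfolding ramsey_number_def by (rule Least_le)
  moreover have "real (nat \<lceil>n\<rceil>) \<le> n + 1" using n ceiling_correct[of n] by simp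
  ultimately show ?thesis using n by linarith
qed

text \<open>The average degree in \<open>T\<close> is less than \<open>2 * q\<close>.\<close>

lemma exists_low_degree_vertex:
  assumes "finite T" "T \<noteq> {}" "E \<subseteq> nsets V 2"
    and few: "real (card (E \<inter> nsets T 2)) < real (card T) * q"
  shows "\<exists>v\<in>T. real (card {u\<in>T. {u, v} \<in> E}) \<le> 2 * q"
proof (rule ccontr)
  assume "\<not> ?thesis"
  then have many: "2 * q \<le> real (card {u\<in>T. {u, v} \<in> E})" if "v \<in> T" for v
    using that by force
  define F where "F = E \<inter> nsets T 2"
  have finF: "finite F" using assms(1) by (simp add: F_def finite_imp_finite_nsets)
  have "(\<Sum>v\<in>T. card {e\<in>F. v \<in> e}) = (\<Sum>e\<in>F. 2)"
  proof (rule sum_multicount_gen[OF assms(1) finF], rule ballI)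
    fix e assume "e \<in> F"
    then have "{v\<in>T. v \<in> e} = e" "card e = 2" by (auto simp: F_def nsets_def)
    then show "card {v\<in>T. v \<in> e} = 2" by simp
  qed
  then have count: "(\<Sum>v\<in>T. real (card {e\<in>F. v \<in> e})) = 2 * real (card F)"
    by (simp flip: of_nat_sum)
  have "real (card T) * (2 * q) \<le> (\<Sum>v\<in>T. real (card {e\<in>F. v \<in> e}))"
  proof (rule sum_bounded_below)
    fix v assume v: "v \<in> T"
    have "card {u\<in>T. {u, v} \<in> E} \<le> card {e\<in>F. v \<in> e}"
    proof (rule card_inj_on_le)
      show "inj_on (\<lambda>u. {u, v}) {u\<in>T. {u, v} \<in> E}"
        by (auto simp: inj_on_def doubleton_eq_iff)
      show "(\<lambda>u. {u, v}) ` {u\<in>T. {u, v} \<in> E} \<subseteq> {e\<in>F. v \<in> e}"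
      proof clarify
        fix u assume u: "u \<in> T" "{u, v} \<in> E"
        then have "{u, v} \<in> nsets T 2"
          using assms(3) v by (auto simp: nsets_def)
        then show "{u, v} \<in> F \<and> v \<in> {u, v}" using u by (simp add: F_def)
      qed
    qed (use finF in simp)
    then show "2 * q \<le> real (card {e\<in>F. v \<in> e})" using many[OF v] by linarith
  qed
  then show False using count few by (simp add: F_def)
qed

lemma ramsey_number_le_if_locally_sparse:
  fixes t :: nat and \<rho> :: real
  assumes H: "finite_simple_graph H" "card (verts H) = t" and t: "4 \<le> t"
    and \<rho>: "0 < \<rho>" "\<rho> \<le> 1" "log 2 (real t) \<le> \<rho>\<^sup>2 * real t"
    and sparse: "\<And>T. T \<subseteq> verts H \<Longrightarrow> T \<noteq> {} \<Longrightarrow>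
      real (card (edges H \<inter> nsets T 2)) < \<rho> * (real (card T))\<^sup>2 + 2 * real (card T) * log 2 (real t)"
  shows "real (ramsey_number H) \<le> 2 powr (645 * \<rho> * log 2 (2 / \<rho>) * real t)"
proof -
  interpret locally_sparse_graph "verts H" "edges H" t \<rho>
  proof
    show "finite (verts H)" using H(1) by (simp add: finite_simple_graph_def)
    fix T assume T: "T \<subseteq> verts H" "T \<noteq> {}"
    have "finite T" using T(1) \<open>finite (verts H)\<close> finite_subset by blast
    have "\<exists>v\<in>T. real (card {u\<in>T. {u, v} \<in> edges H}) \<le> 2 * (\<rho> * real (card T) + 2 * log 2 (real t))"
      using \<open>finite T\<close> T(2) H(1) sparse[OF T] unfolding finite_simple_graph_def
      by (intro exists_low_degree_vertex) (auto simp: power2_eq_square algebra_simps)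
    then show "\<exists>v\<in>T. real (card {u\<in>T. {u, v} \<in> edges H}) \<le> 2 * \<rho> * real (card T) + 4 * log 2 (real t)"
      by (simp add: algebra_simps)
  qed (use assms in auto)
  have Lt: "1 \<le> L * real t"
    using \<rho>t_ge mult_right_mono[OF \<rho>_le_L, of "real t"] log_t_ge_2 by simp
  have "real (ramsey_number H) \<le> 2 * 2 powr (644 * L * real t)"
    using H(1) mono_copy_in_large_set Lt
    by (intro ramsey_number_le) (auto intro: ge_one_powr_ge_zero simp: mult.assoc)
  also have "\<dots> = 2 powr (1 + 644 * L * real t)" by (simp add: powr_add)
  also have "\<dots> \<le> 2 powr (645 * \<rho> * log 2 (2 / \<rho>) * real t)"
    using Lt by (intro powr_mono) (auto simp: L_def mult_ac)
  finally show ?thesis .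
qed

section \<open>Edge counts in the random graph\<close>

lemma expectation_two_power_edges:
  assumes \<rho>: "0 \<le> \<rho>" "\<rho> \<le> 1" and "finite A" "F \<subseteq> A"
  shows "measure_pmf.expectation (Pi_pmf A False (\<lambda>_. bernoulli_pmf \<rho>)) (\<lambda>b. 2 ^ card {e\<in>F. b e})
      = (1 + \<rho>) ^ card F"
    and "integrable (measure_pmf (Pi_pmf A False (\<lambda>_. bernoulli_pmf \<rho>))) (\<lambda>b. 2 ^ card {e\<in>F. b e} :: real)"
proof -
  define f :: "'a \<Rightarrow> bool \<Rightarrow> real" where "f e v = (if e \<in> F \<and> v then 2 else 1)" for e v
  have prod: "(2::real) ^ card {e\<in>F. b e} = (\<Prod>e\<in>A. f e (b e))" for b
  proof -
    have "(\<Prod>e\<in>A. f e (b e)) = (\<Prod>e\<in>{e\<in>F. b e}. 2)"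
      using assms(3,4) by (intro prod.mono_neutral_cong_right) (auto simp: f_def)
    then show ?thesis by simp
  qed
  have int: "integrable (measure_pmf (bernoulli_pmf \<rho>)) (f e)" for e
    by (intro integrable_measure_pmf_finite) auto
  have "measure_pmf.expectation (Pi_pmf A False (\<lambda>_. bernoulli_pmf \<rho>)) (\<lambda>b. \<Prod>e\<in>A. f e (b e))
      = (\<Prod>e\<in>A. measure_pmf.expectation (bernoulli_pmf \<rho>) (f e))"
    using assms(3)
  proof (rule expectation_prod_Pi_pmf)
    show "0 \<le> f e v" for e v by (simp add: f_def)
  qed (rule int)
  also have "\<dots> = (\<Prod>e\<in>F. 1 + \<rho>)"
    using assms by (intro prod.mono_neutral_cong_right) (auto simp: f_def)
  finally show "measure_pmf.expectation (Pi_pmf A False (\<lambda>_. bernoulli_pmf \<rho>)) (\<lambda>b. 2 ^ card {e\<in>F. b e})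
      = (1 + \<rho>) ^ card F"
    by (simp add: prod)
  show "integrable (measure_pmf (Pi_pmf A False (\<lambda>_. bernoulli_pmf \<rho>))) (\<lambda>b. 2 ^ card {e\<in>F. b e} :: real)"
    unfolding prod using assms(3) int by (intro integrable_prod_Pi_pmf)
qed

text \<open>Markov's inequality for the exponential moment with base 2.\<close>

lemma prob_many_edges_le:
  fixes q :: real
  assumes \<rho>: "0 \<le> \<rho>" "\<rho> \<le> 1" and "finite A" "F \<subseteq> A"
  shows "measure_pmf.prob (Pi_pmf A False (\<lambda>_. bernoulli_pmf \<rho>)) {b. q \<le> real (card {e\<in>F. b e})}
     \<le> 2 powr (- q) * (1 + \<rho>) ^ card F"
proof -
  let ?M = "measure_pmf (Pi_pmf A False (\<lambda>_. bernoulli_pmf \<rho>))"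
  have "{b. q \<le> real (card {e\<in>F. b e})} = {b\<in>space ?M. 2 powr q \<le> 2 ^ card {e\<in>F. b e}}"
    by (simp add: powr_realpow[symmetric])
  also have "measure ?M \<dots> \<le> measure_pmf.expectation (Pi_pmf A False (\<lambda>_. bernoulli_pmf \<rho>)) (\<lambda>b. 2 ^ card {e\<in>F. b e}) / 2 powr q"
    using expectation_two_power_edges(2)[OF assms]
    by (intro integral_Markov_inequality_measure[where A = UNIV]) auto
  also have "\<dots> = 2 powr (- q) * (1 + \<rho>) ^ card F"
    using expectation_two_power_edges(1)[OF assms] by (simp add: powr_minus divide_inverse mult.commute)
  finally show ?thesis .
qed

text \<open>A set of \<open>s\<close> vertices spans at most \<open>s\<^sup>2 / 2\<close> pairs, so the exponential moment is at most
  \<open>2 powr (\<rho> * s\<^sup>2)\<close> and cancels the first summand of the threshold. The second one leaves the probability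
  \<open>t powr (- 2 * s)\<close>, small enough for a union bound over all vertex sets, which sums to
  \<open>(1 + 1 / t\<^sup>2) ^ t - 1\<close>.\<close>

lemma prob_dense_subset_le:
  fixes t :: nat and \<rho> :: real
  assumes \<rho>: "0 \<le> \<rho>" "\<rho> \<le> 1" and t: "1 \<le> t"
  shows "measure_pmf.prob (Pi_pmf (nsets {..<t} 2) False (\<lambda>_. bernoulli_pmf \<rho>))
     {b. \<exists>T. T \<subseteq> {..<t} \<and> T \<noteq> {} \<and>
        \<rho> * (real (card T))\<^sup>2 + 2 * real (card T) * log 2 (real t) \<le> real (card {e\<in>nsets T 2. b e})}
     \<le> exp (1 / real t) - 1" (is "measure_pmf.prob ?M ?bad \<le> _")
proof -
  define bad where "bad T = {b. \<rho> * (real (card T))\<^sup>2 + 2 * real (card T) * log 2 (real t) \<le> real (card {e\<in>nsets T 2. b e})}"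
    for T :: "nat set"
  define N where "N = Pow {..<t} - {{}}"
  have finN: "finite N" by (simp add: N_def)
  have "?bad = (\<Union>T\<in>N. bad T)" by (auto simp: bad_def N_def)
  then have "measure_pmf.prob ?M ?bad \<le> (\<Sum>T\<in>N. measure_pmf.prob ?M (bad T))"
    using finN by (simp add: measure_pmf.finite_measure_subadditive_finite)
  also have "\<dots> \<le> (\<Sum>T\<in>N. (1 / (real t)\<^sup>2) ^ card T)"
  proof (rule sum_mono)
    fix T assume T: "T \<in> N"
    then have finT: "finite T" by (auto simp: N_def intro: finite_subset)
    define s where "s = real (card T)"
    have "nsets T 2 \<subseteq> nsets {..<t} 2" using T by (intro nsets_mono) (auto simp: N_def)
    then have "measure_pmf.prob ?M (bad T) \<le> 2 powr (- (\<rho> * s\<^sup>2 + 2 * s * log 2 (real t))) * (1 + \<rho>) ^ card (nsets T 2)"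
      unfolding bad_def s_def using \<rho> by (intro prob_many_edges_le) (auto simp: finite_imp_finite_nsets)
    also have "(1 + \<rho>) ^ card (nsets T 2) \<le> 2 powr (\<rho> * s\<^sup>2)"
    proof -
      have "2 * card (nsets T 2) \<le> card T * card T"
      proof -
        have "2 * (card T * (card T - 1) div 2) \<le> card T * (card T - 1)" by simp
        also have "\<dots> \<le> card T * card T" by (intro mult_le_mono2) simp
        finally show ?thesis unfolding card_nsets choose_two .
      qed
      then have "real (2 * card (nsets T 2)) \<le> real (card T * card T)" by (simp only: of_nat_le_iff)
      then have "2 * real (card (nsets T 2)) \<le> s\<^sup>2" by (simp add: s_def power2_eq_square)
      then have *: "\<rho> * (2 * real (card (nsets T 2))) \<le> \<rho> * s\<^sup>2" using \<rho>(1) by (intro mult_left_mono)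
      have "(1 + \<rho>) ^ card (nsets T 2) \<le> (2 powr (2 * \<rho>)) ^ card (nsets T 2)"
        using \<rho> by (intro power_mono one_plus_le_two_powr) auto
      also have "\<dots> = 2 powr (\<rho> * (2 * real (card (nsets T 2))))"
        by (simp add: powr_realpow[symmetric] powr_powr mult_ac)
      finally show ?thesis using * by (smt (verit) powr_mono)
    qed
    also have "2 powr (- (\<rho> * s\<^sup>2 + 2 * s * log 2 (real t))) * 2 powr (\<rho> * s\<^sup>2) = 2 powr (log 2 (real t) * (- 2 * s))"
      by (simp add: powr_add[symmetric] mult_ac)
    also have "\<dots> = real t powr (- 2 * s)" using t powr_powr[of 2 "log 2 (real t)" "- 2 * s"] by simp
    also have "\<dots> = (1 / (real t)\<^sup>2) ^ card T"
    proof -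
      have "real t powr (2 * s) = (real t powr 2) powr s" by (simp only: powr_powr)
      also have "\<dots> = ((real t)\<^sup>2) ^ card T" using t by (simp add: powr_realpow s_def)
      finally show ?thesis by (simp add: powr_minus power_inverse divide_inverse)
    qed
    finally show "measure_pmf.prob ?M (bad T) \<le> (1 / (real t)\<^sup>2) ^ card T" by simp
  qed
  also have "\<dots> = (1 + 1 / (real t)\<^sup>2) ^ t - 1"
    unfolding N_def using sum_power_card_Pow[of "{..<t}" "1 / (real t)\<^sup>2"] by (subst sum_diff1) auto
  also have "(1 + 1 / (real t)\<^sup>2) ^ t \<le> exp (1 / (real t)\<^sup>2) ^ t"
    by (intro power_mono exp_ge_add_one_self) auto
  also have "exp (1 / (real t)\<^sup>2) ^ t = exp (1 / real t)"
    using t by (simp add: exp_of_nat_mult[symmetric] power2_eq_square)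
  finally show ?thesis by simp
qed

text \<open>Outcomes outside the support need not be simple graphs, hence the restriction to \<^term>\<open>set_pmf\<close> inside the
  proof.\<close>

lemma prob_ramsey_number_le:
  fixes t :: nat and \<rho> :: real
  assumes t: "4 \<le> t" and \<rho>: "0 < \<rho>" "\<rho> \<le> 1" "log 2 (real t) \<le> \<rho>\<^sup>2 * real t"
  shows "2 - exp (1 / real t) \<le> measure_pmf.prob (binomial_random_graph t \<rho>)
     {H. real (ramsey_number H) \<le> 2 powr (645 * \<rho> * log 2 (2 / \<rho>) * real t)}"
proof -
  define M where "M = Pi_pmf (nsets {..<t} 2) False (\<lambda>_. bernoulli_pmf \<rho>)"
  define bad where "bad = {b. \<exists>T. T \<subseteq> {..<t} \<and> T \<noteq> {} \<and>
        \<rho> * (real (card T))\<^sup>2 + 2 * real (card T) * log 2 (real t) \<le> real (card {e\<in>nsets T 2. b e})}"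
  define G where "G = (\<lambda>b. ({..<t}, {e :: nat set. b e}))"
  define good where "good = {H :: nat sgraph. real (ramsey_number H) \<le> 2 powr (645 * \<rho> * log 2 (2 / \<rho>) * real t)}"
  have MG: "binomial_random_graph t \<rho> = map_pmf G M"
    by (simp add: binomial_random_graph_def M_def G_def)
  have "G b \<in> good" if b: "b \<in> set_pmf M" "b \<notin> bad" for b
  proof -
    have "finite_simple_graph (G b)"
      using b(1) MG by (intro finite_simple_graph_binomial_random_graph[of _ t \<rho>]) auto
    moreover have "real (card (edges (G b) \<inter> nsets T 2)) < \<rho> * (real (card T))\<^sup>2 + 2 * real (card T) * log 2 (real t)"
      if "T \<subseteq> verts (G b)" "T \<noteq> {}" for T
    proof -
      have "edges (G b) \<inter> nsets T 2 = {e\<in>nsets T 2. b e}" by (auto simp: G_def)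
      then show ?thesis using b(2) that by (auto simp: bad_def G_def not_le)
    qed
    moreover have "card (verts (G b)) = t" by (simp add: G_def)
    ultimately show ?thesis
      unfolding good_def mem_Collect_eq using t \<rho> by (intro ramsey_number_le_if_locally_sparse)
  qed
  then have "measure_pmf.prob M (UNIV - bad) \<le> measure_pmf.prob M (G -` good)"
    by (intro measure_pmf.finite_measure_mono_AE AE_pmfI) auto
  moreover have "measure_pmf.prob M (UNIV - bad) = 1 - measure_pmf.prob M bad"
    using measure_pmf.prob_compl[of bad M] by simp
  moreover have "measure_pmf.prob M bad \<le> exp (1 / real t) - 1"
    unfolding M_def bad_def using t \<rho> by (intro prob_dense_subset_le) auto
  ultimately show ?thesis unfolding MG good_def[symmetric] by simp
qed

theorem theorem1p5:
  shows "\<exists>c c' :: real. c > 0 \<and> c' > 0 \<and>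
    (\<forall>\<rho> :: nat \<Rightarrow> real.
       (\<forall>t. 0 \<le> \<rho> t \<and> \<rho> t \<le> 1) \<longrightarrow>
       (\<forall>\<^sub>F t in sequentially. \<rho> t \<ge> c' * (log 2 (real t)) powr (3/2) / sqrt (real t)) \<longrightarrow>
       (\<lambda>t. measure_pmf.prob (binomial_random_graph t (\<rho> t))
              {H. real (ramsey_number H) \<le> 2 powr (c * \<rho> t * log 2 (2 / \<rho> t) * real t)})
         \<longlonglongrightarrow> 1)"
proof (intro exI conjI allI impI)
  fix \<rho> :: "nat \<Rightarrow> real"
  assume range: "\<forall>t. 0 \<le> \<rho> t \<and> \<rho> t \<le> 1"
    and large: "\<forall>\<^sub>F t in sequentially. \<rho> t \<ge> 1 * (log 2 (real t)) powr (3/2) / sqrt (real t)"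
  let ?P = "\<lambda>t. measure_pmf.prob (binomial_random_graph t (\<rho> t))
              {H. real (ramsey_number H) \<le> 2 powr (645 * \<rho> t * log 2 (2 / \<rho> t) * real t)}"
  have "\<forall>\<^sub>F t in sequentially. 2 - exp (1 / real t) \<le> ?P t"
    using large eventually_ge_at_top[of 4]
  proof eventually_elim
    case (elim t)
    define l where "l = log 2 (real t)"
    have l: "1 \<le> l" using elim(2) by (simp add: l_def le_log_iff)
    have lower: "l powr (3/2) / sqrt (real t) \<le> \<rho> t" using elim(1) by (simp add: l_def)
    moreover have "0 < l powr (3/2) / sqrt (real t)" using l elim(2) by simp
    ultimately have pos: "0 < \<rho> t" by linarith
    \<comment> \<open>The density condition enters as \<open>\<rho>\<^sup>2 * t \<ge> log 2 t\<close>.\<close>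
    have "l \<le> l ^ 3" using l by (simp add: self_le_power)
    also have "l ^ 3 = (l powr (3/2))\<^sup>2"
      using l powr_realpow[of l 3] by (simp add: powr_power)
    also have "\<dots> = (l powr (3/2) / sqrt (real t))\<^sup>2 * real t"
      using elim(2) by (simp add: power_divide)
    also have "\<dots> \<le> (\<rho> t)\<^sup>2 * real t"
      using lower l by (intro mult_right_mono power_mono) auto
    finally show ?case
      using elim(2) pos range unfolding l_def by (intro prob_ramsey_number_le) auto
  qed
  moreover have "\<forall>\<^sub>F t in sequentially. ?P t \<le> 1" by simp
  moreover have "(\<lambda>t. 2 - exp (1 / real t)) \<longlonglongrightarrow> 2 - exp 0"
    by (intro tendsto_intros lim_1_over_n)
  then have "(\<lambda>t. 2 - exp (1 / real t)) \<longlonglongrightarrow> 1" by simp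
  ultimately show "?P \<longlonglongrightarrow> 1"
    by (rule tendsto_sandwich[OF _ _ _ tendsto_const])
qed simp_all

end
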